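(* Let $1\le p<\infty$. The maximal hull $\mathcal K_p^{max}$ of the ideal of $p$-compact operators coincides isometrically with $\Pi_p^{dual}$, the dual ideal of the ideal of absolutely $p$-summing operators. That is, for all Banach spaces $E,F$ and every bounded operator $T\colon E\to F$, $T\in\mathcal K_p^{max}(E;F)$ if and only if $T'\in\Pi_p(F';E')$, and then the norm of $T$ in $\mathcal K_p^{max}(E;F)$ equals $\pi_p(T')$.
   Context: For a Banach space $E$ and $1\le p<\infty$, $\ell_p(E)$ is the space of sequences $(x_n)_n$ in $E$ with $\|(x_n)_n\|_p=(\sum_n\|x_n\|^p)^{1/p}<\infty$. With $\frac1p+\frac1{p'}=1$, for $(x_n)_n\in\ell_p(E)$ put $p\text{-}\mathrm{co}\{x_n\}=\{\sum_{n=1}^\infty\alpha_nx_n:(\alpha_n)_n\in B_{\ell_{p'}}\}$, where $\ell_{p'}$ is replaced by $c_0$ if $p=1$. A bounded operator $T\colon E\to F$ is $p$-compact, $T\in\mathcal K_p(E;F)$, if $T(B_E)\subset p\text{-}\mathrm{co}\{x_n\}$ for some $(x_n)_n\in\ell_p(F)$, and $\kappa_p(T)=\inf\{\|(x_n)_n\|_p: T(B_E)\subset p\text{-}\mathrm{co}\{x_n\}\}$. The maximal hull $\mathcal A^{max}$ of a Banach operator ideal $(\mathcal A,\|\cdot\|_{\mathcal A})$ consists of those bounded $T\colon E\to F$ with $\|T\|_{\mathcal A^{max}}:=\sup\{\|Q_LTI_M\|_{\mathcal A}\}<\infty$, the supremum being over all finite dimensional subspaces $M\subset E$ (inclusion $I_M\colon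 M\to E$) and all closed finite codimensional subspaces $L\subset F$ (quotient map $Q_L\colon F\to F/L$). $\Pi_p$ is the ideal of absolutely $p$-summing operators with the $p$-summing norm $\pi_p$. The dual ideal of $\mathcal A$ is $\mathcal A^{dual}(E;F)=\{T:T'\in\mathcal A(F';E')\}$ with norm $\|T'\|_{\mathcal A}$. *)

theory Defs
  imports "HOL-Analysis.Analysis"
begin

text \<open>
  Scalars range over a type of class \<open>{real_normed_field, euclidean_space}\<close>. Such a type is a
  finite-dimensional real field with a multiplicative norm, so it is the real or the complex numbers;
  both types are instances. A Banach space over these scalars is a type of class \<open>banach\<close> with a
  scalar multiplication as in the next locale (\<open>scaleR\<close> in the real case).
\<close>

locale normed_space_over = vector_space scale
  for scale :: "'k::{real_normed_field,euclidean_space} \<Rightarrow> 'a::real_normed_vector \<Rightarrow> 'a" +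
  assumes norm_scale: "norm (scale c x) = norm c * norm x"
    and scale_of_real: "scale (of_real r) x = r *\<^sub>R x"

lemma normed_space_over_scaleR:
  "normed_space_over (scaleR :: real \<Rightarrow> 'a::real_normed_vector \<Rightarrow> 'a)"
  by unfold_locales (auto simp: scaleR_add_right scaleR_add_left)

lemma normed_space_over_complex: "normed_space_over ((*) :: complex \<Rightarrow> complex \<Rightarrow> complex)"
  by unfold_locales (auto simp: algebra_simps norm_mult scaleR_conv_of_real)


text \<open>
  Finite-dimensional subspaces, quotients and duals vary inside the statement, so they cannot be
  types. They are normed spaces with an explicit carrier. A map between two such spaces is an
  HOL function of which only the values on the carrier of the domain matter.
\<close>

record ('k, 'a) nspace =
  carrier :: "'a set"
  add :: "'a \<Rightarrow> 'a \<Rightarrow> 'a"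
  zero :: "'a"
  smult :: "'k \<Rightarrow> 'a \<Rightarrow> 'a"
  nrm :: "'a \<Rightarrow> real"

definition unit_ball :: "('k, 'a) nspace \<Rightarrow> 'a set" where
  "unit_ball X = {x \<in> carrier X. nrm X x \<le> 1}"

definition bounded_ops :: "('k, 'a) nspace \<Rightarrow> ('k, 'b) nspace \<Rightarrow> ('a \<Rightarrow> 'b) set" where
  "bounded_ops X Y = {u.
     (\<forall>x\<in>carrier X. u x \<in> carrier Y) \<and>
     (\<forall>x\<in>carrier X. \<forall>y\<in>carrier X. u (add X x y) = add Y (u x) (u y)) \<and>
     (\<forall>c. \<forall>x\<in>carrier X. u (smult X c x) = smult Y c (u x)) \<and>
     (\<exists>C. \<forall>x\<in>carrier X. nrm Y (u x) \<le> C * nrm X x)}"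

definition subspace_nspace ::
    "('k \<Rightarrow> 'a::real_normed_vector \<Rightarrow> 'a) \<Rightarrow> 'a set \<Rightarrow> ('k, 'a) nspace" where
  "subspace_nspace s M = \<lparr>carrier = M, add = (+), zero = 0, smult = s, nrm = norm\<rparr>"

definition whole_nspace :: "('k \<Rightarrow> 'a::real_normed_vector \<Rightarrow> 'a) \<Rightarrow> ('k, 'a) nspace" where
  "whole_nspace s = subspace_nspace s UNIV"

definition coset :: "'a::ab_group_add set \<Rightarrow> 'a \<Rightarrow> 'a set" where
  "coset L y = (\<lambda>l. y + l) ` L"

text \<open>
  The points of the quotient by \<open>L\<close> are the cosets of \<open>L\<close>, and \<open>coset L\<close> is the quotient map. In
  \<open>smult\<close>, adding \<open>L\<close> is needed only for the scalar \<open>0\<close>.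
\<close>

definition quotient_nspace ::
    "('k \<Rightarrow> 'a::real_normed_vector \<Rightarrow> 'a) \<Rightarrow> 'a set \<Rightarrow> ('k, 'a set) nspace" where
  "quotient_nspace s L =
     \<lparr>carrier = range (coset L),
      add = (\<lambda>A B. {a + b |a b. a \<in> A \<and> b \<in> B}),
      zero = L,
      smult = (\<lambda>c A. {s c a + l |a l. a \<in> A \<and> l \<in> L}),
      nrm = (\<lambda>A. INF a\<in>A. norm a)\<rparr>"

text \<open>Functionals are \<open>undefined\<close> off the carrier, so that each is represented only once.\<close>

definition dual_nspace ::
    "('k::{real_normed_field,euclidean_space}, 'a) nspace \<Rightarrow> ('k, 'a \<Rightarrow> 'k) nspace" where
  "dual_nspace X =
     \<lparr>carrier = bounded_ops X (whole_nspace (*)) \<inter> extensional (carrier X),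
      add = (\<lambda>f g. \<lambda>x\<in>carrier X. f x + g x),
      zero = (\<lambda>x\<in>carrier X. 0),
      smult = (\<lambda>c f. \<lambda>x\<in>carrier X. c * f x),
      nrm = (\<lambda>f. SUP x\<in>unit_ball X. norm (f x))\<rparr>"

definition adjoint_op ::
    "('k::{real_normed_field,euclidean_space}, 'a) nspace \<Rightarrow> ('k, 'b) nspace \<Rightarrow>
     ('a \<Rightarrow> 'b) \<Rightarrow> ('b \<Rightarrow> 'k) \<Rightarrow> 'a \<Rightarrow> 'k" where
  "adjoint_op X Y T = (\<lambda>f\<in>carrier (dual_nspace Y). \<lambda>x\<in>carrier X. f (T x))"


primrec partial_sum :: "('k, 'a) nspace \<Rightarrow> (nat \<Rightarrow> 'a) \<Rightarrow> nat \<Rightarrow> 'a" where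
  "partial_sum X f 0 = zero X"
| "partial_sum X f (Suc n) = add X (partial_sum X f n) (f n)"

definition sums_in :: "('k::ring_1, 'a) nspace \<Rightarrow> (nat \<Rightarrow> 'a) \<Rightarrow> 'a \<Rightarrow> bool" where
  "sums_in X f y \<longleftrightarrow> y \<in> carrier X \<and>
     (\<lambda>n. nrm X (add X (partial_sum X f n) (smult X (- 1) y))) \<longlonglongrightarrow> 0"

definition lp_space :: "real \<Rightarrow> ('k, 'a) nspace \<Rightarrow> (nat \<Rightarrow> 'a) set" where
  "lp_space p X = {x. (\<forall>n. x n \<in> carrier X) \<and> summable (\<lambda>n. nrm X (x n) powr p)}"

definition lp_norm :: "real \<Rightarrow> ('k, 'a) nspace \<Rightarrow> (nat \<Rightarrow> 'a) \<Rightarrow> real" where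
  "lp_norm p X x = (\<Sum>n. nrm X (x n) powr p) powr (1 / p)"

text \<open>
  The unit ball of scalar \<open>\<ell>\<close>-sequences with exponent conjugate to \<open>p\<close>, that is \<open>p / (p - 1)\<close>;
  for \<open>p = 1\<close> it is the unit ball of the null sequences.
\<close>

definition conj_ball :: "real \<Rightarrow> (nat \<Rightarrow> 'k::{real_normed_field,euclidean_space}) set" where
  "conj_ball p =
     (if p = 1 then {\<alpha>. \<alpha> \<longlonglongrightarrow> 0 \<and> (\<forall>n. norm (\<alpha> n) \<le> 1)}
      else {\<alpha> \<in> lp_space (p / (p - 1)) (whole_nspace ((*) :: 'k \<Rightarrow> 'k \<Rightarrow> 'k)).
              lp_norm (p / (p - 1)) (whole_nspace ((*) :: 'k \<Rightarrow> 'k \<Rightarrow> 'k)) \<alpha> \<le> 1})"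

definition p_co ::
    "real \<Rightarrow> ('k::{real_normed_field,euclidean_space}, 'a) nspace \<Rightarrow> (nat \<Rightarrow> 'a) \<Rightarrow> 'a set" where
  "p_co p X x = {y. \<exists>\<alpha>\<in>conj_ball p. sums_in X (\<lambda>n. smult X (\<alpha> n) (x n)) y}"


text \<open>
  The norm of an operator ideal is a function with values in \<open>[0, \<infinity>]\<close> that is \<open>\<infinity>\<close> outside the
  ideal. The infimum of the empty set is \<open>\<infinity>\<close>, so among the bounded operators \<open>p_compact_norm\<close> is
  finite exactly on the \<open>p\<close>-compact ones, and \<open>p_summing_norm\<close> exactly on \<open>p_summing\<close>.
\<close>

definition p_compact_norm ::
    "real \<Rightarrow> ('k::{real_normed_field,euclidean_space}, 'a) nspace \<Rightarrow> ('k, 'b) nspace \<Rightarrow>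
     ('a \<Rightarrow> 'b) \<Rightarrow> ennreal" where
  "p_compact_norm p X Y u =
     (INF y\<in>{y \<in> lp_space p Y. u ` unit_ball X \<subseteq> p_co p Y y}. ennreal (lp_norm p Y y))"

definition p_summing_bound ::
    "real \<Rightarrow> ('k::{real_normed_field,euclidean_space}, 'a) nspace \<Rightarrow> ('k, 'b) nspace \<Rightarrow>
     ('a \<Rightarrow> 'b) \<Rightarrow> real \<Rightarrow> bool" where
  "p_summing_bound p X Y u C \<longleftrightarrow>
     (\<forall>(n::nat) x. (\<forall>i<n. x i \<in> carrier X) \<longrightarrow>
        (\<Sum>i<n. nrm Y (u (x i)) powr p) powr (1 / p)
        \<le> C * (SUP f\<in>unit_ball (dual_nspace X). (\<Sum>i<n. norm (f (x i)) powr p) powr (1 / p)))"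

definition p_summing ::
    "real \<Rightarrow> ('k::{real_normed_field,euclidean_space}, 'a) nspace \<Rightarrow> ('k, 'b) nspace \<Rightarrow>
     ('a \<Rightarrow> 'b) set" where
  "p_summing p X Y = {u \<in> bounded_ops X Y. \<exists>C\<ge>0. p_summing_bound p X Y u C}"

definition p_summing_norm ::
    "real \<Rightarrow> ('k::{real_normed_field,euclidean_space}, 'a) nspace \<Rightarrow> ('k, 'b) nspace \<Rightarrow>
     ('a \<Rightarrow> 'b) \<Rightarrow> ennreal" where
  "p_summing_norm p X Y u = (INF C\<in>{C. 0 \<le> C \<and> p_summing_bound p X Y u C}. ennreal C)"

definition dual_ideal ::
    "(('k, 'b \<Rightarrow> 'k) nspace \<Rightarrow> ('k, 'a \<Rightarrow> 'k) nspace \<Rightarrow> (('b \<Rightarrow> 'k) \<Rightarrow> 'a \<Rightarrow> 'k) set) \<Rightarrow>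
     ('k::{real_normed_field,euclidean_space}, 'a) nspace \<Rightarrow> ('k, 'b) nspace \<Rightarrow> ('a \<Rightarrow> 'b) set" where
  "dual_ideal A X Y =
     {T \<in> bounded_ops X Y. adjoint_op X Y T \<in> A (dual_nspace Y) (dual_nspace X)}"

definition dual_ideal_norm ::
    "(('k, 'b \<Rightarrow> 'k) nspace \<Rightarrow> ('k, 'a \<Rightarrow> 'k) nspace \<Rightarrow> (('b \<Rightarrow> 'k) \<Rightarrow> 'a \<Rightarrow> 'k) \<Rightarrow> ennreal) \<Rightarrow>
     ('k::{real_normed_field,euclidean_space}, 'a) nspace \<Rightarrow> ('k, 'b) nspace \<Rightarrow>
     ('a \<Rightarrow> 'b) \<Rightarrow> ennreal" where
  "dual_ideal_norm N X Y T = N (dual_nspace Y) (dual_nspace X) (adjoint_op X Y T)"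


definition fin_dim_subspaces ::
    "('k::field \<Rightarrow> 'a::ab_group_add \<Rightarrow> 'a) \<Rightarrow> 'a set set" where
  "fin_dim_subspaces s = {M. \<exists>B. finite B \<and> M = module.span s B}"

definition closed_fin_codim_subspaces ::
    "('k::field \<Rightarrow> 'a::real_normed_vector \<Rightarrow> 'a) \<Rightarrow> 'a set set" where
  "closed_fin_codim_subspaces s =
     {L. module.subspace s L \<and> closed L \<and> (\<exists>B. finite B \<and> module.span s (L \<union> B) = UNIV)}"

definition max_hull_norm ::
    "(('k, 'a) nspace \<Rightarrow> ('k, 'b set) nspace \<Rightarrow> ('a \<Rightarrow> 'b set) \<Rightarrow> ennreal) \<Rightarrow>
     ('k::{real_normed_field,euclidean_space} \<Rightarrow> 'a::real_normed_vector \<Rightarrow> 'a) \<Rightarrow>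
     ('k \<Rightarrow> 'b::real_normed_vector \<Rightarrow> 'b) \<Rightarrow> ('a \<Rightarrow> 'b) \<Rightarrow> ennreal" where
  "max_hull_norm N sE sF T =
     (SUP M\<in>fin_dim_subspaces sE. SUP L\<in>closed_fin_codim_subspaces sF.
        N (subspace_nspace sE M) (quotient_nspace sF L) (\<lambda>x. coset L (T x)))"

definition max_hull ::
    "(('k, 'a) nspace \<Rightarrow> ('k, 'b set) nspace \<Rightarrow> ('a \<Rightarrow> 'b set) \<Rightarrow> ennreal) \<Rightarrow>
     ('k::{real_normed_field,euclidean_space} \<Rightarrow> 'a::real_normed_vector \<Rightarrow> 'a) \<Rightarrow>
     ('k \<Rightarrow> 'b::real_normed_vector \<Rightarrow> 'b) \<Rightarrow> ('a \<Rightarrow> 'b) set" where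
  "max_hull N sE sF =
     {T \<in> bounded_ops (whole_nspace sE) (whole_nspace sF). max_hull_norm N sE sF T < \<infinity>}"

end

(*
  A p-compact operator has a p-summing adjoint with no larger norm: if T maps the unit ball into
  p-co (y_n), Hoelder's inequality bounds the norm of T' f by the l_p norm of (f (y_n)). Given finitely
  many functionals on F, this is applied to Q_L T I_M, where L is the intersection of their kernels
  and M is spanned by points that almost attain the norms of their images under T'.

  Conversely, let T' be p-summing and L closed of finite codimension. The unit ball of F has a finite
  net modulo L, so Pietsch's domination theorem becomes a minimax statement on a finite simplex and
  yields finitely many z_j with norm (T' f) <= (sum_j |f (z_j)|^p)^(1/p) for all f vanishing on L.
  For x in the unit ball, extending (f (z_j))_j |-> f (T x) to all of l_p^N by Hahn-Banach produces
  the coefficients that exhibit the coset of T x as an element of p-co (z_j).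
*)

theory Submission
  imports Defs "HOL-Library.Function_Algebras"
begin

section \<open>Scalars\<close>

text \<open>All duality arguments rest on one tool, \<open>mazur_orlicz\<close>: a linear functional
  that stays below a sublinear \<open>q\<close> and above prescribed values on a convex cone. With
  the maximum of coordinates as \<open>q\<close> it gives the weights in the minimax statement; with
  a p-sum as \<open>q\<close> and a ray as cone it gives norming functionals; with a p-sum and a
  graph as cone it gives the coefficients of a point of a p-convex hull. The obstacle in the
  converse is that the weak p-norm of finitely many functionals on F is a supremum over the ball of
  the bidual, whereas the \<open>z_j\<close> must lie in F. Duality of finite p-sums first brings
  the supremum down to the ball of F. Passing to a finite net then costs a factor
  \<open>1 - \<delta>\<close>, so the domination holds only with constants C' > C; the slack
  disappears when C' tends to C. Functionals vanishing on L see exactly the quotient: their values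
  do not depend on representatives, and the coordinates modulo L are themselves such functionals, so
  a vector that all of them kill lies in L.\<close>

lemma inner_mult_same:
  fixes c x y :: "'k::{real_normed_field,euclidean_space}"
  shows "(c * x) \<bullet> (c * y) = (norm c)\<^sup>2 * (x \<bullet> y)"
proof -
  \<comment> \<open>Polarization expresses the inner product by norms, and the norm is
    multiplicative.\<close>
  have "(c * x) \<bullet> (c * y) = ((norm (c * (x + y)))\<^sup>2 - (norm (c * x))\<^sup>2 - (norm (c * y))\<^sup>2) / 2"
    by (simp add: dot_norm distrib_left)
  also have "\<dots> = (norm c)\<^sup>2 * (x \<bullet> y)"
    unfolding norm_mult dot_norm[of x y] by (simp add: algebra_simps)
  finally show ?thesis .
qed

text \<open>
  The norm of the scalars is at once multiplicative and Euclidean, so multiplication by \<open>c\<close> is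
  \<open>norm c\<close> times an isometry; \<open>field_cnj c\<close> is the scalar that acts as its adjoint, and \<open>x \<bullet> 1\<close>
  is the real part of \<open>x\<close>. No case distinction between real and complex scalars is needed.
\<close>

definition field_cnj :: "'k::{real_normed_field,euclidean_space} \<Rightarrow> 'k" where
  "field_cnj c = of_real ((norm c)\<^sup>2) / c"

lemma norm_field_cnj: "norm (field_cnj c) = norm c"
  by (simp add: field_cnj_def norm_divide norm_mult power2_eq_square)

lemma mult_field_cnj: "c * field_cnj c = of_real ((norm c)\<^sup>2)"
  by (simp add: field_cnj_def)

text \<open>Rewrites an inner product as the real part of a product, so that the Riesz
  representation of a real-linear functional becomes multiplication by a scalar.\<close>

lemma inner_field_cnj:
  fixes x c :: "'k::{real_normed_field,euclidean_space}"
  shows "(x * field_cnj c) \<bullet> 1 = x \<bullet> c"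
proof (cases "c = 0")
  case False
  have "(norm c)\<^sup>2 * ((x * field_cnj c) \<bullet> 1) = (c * (x * field_cnj c)) \<bullet> (c * 1)"
    by (rule inner_mult_same[symmetric])
  also have "c * (x * field_cnj c) = (norm c)\<^sup>2 *\<^sub>R x"
    using mult_field_cnj[of c] by (simp add: scaleR_conv_of_real ac_simps)
  also have "((norm c)\<^sup>2 *\<^sub>R x) \<bullet> (c * 1) = (norm c)\<^sup>2 * (x \<bullet> c)"
    by simp
  finally show ?thesis using False by simp
qed (simp add: field_cnj_def)

lemma inner_of_real_one: "(of_real r :: 'k::{real_normed_field,euclidean_space}) \<bullet> 1 = r"
  by (simp add: of_real_def dot_square_norm)

lemma inner_one_le_norm: "(x :: 'k::{real_normed_field,euclidean_space}) \<bullet> 1 \<le> norm x"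
  using norm_cauchy_schwarz[of x 1] by simp

text \<open>Testing with minus the conjugate of \<open>s\<close> suffices. This turns a one-sided
  real inequality that is stable under scalar multiples into an equation.\<close>

lemma eq_0_if_inner_one_nonneg:
  fixes s :: "'k::{real_normed_field,euclidean_space}"
  assumes "\<And>c. 0 \<le> (c * s) \<bullet> 1"
  shows "s = 0"
proof -
  have "(- field_cnj s * s) \<bullet> 1 = - ((norm s)\<^sup>2)"
    by (metis inner_minus_left inner_of_real_one mult.commute mult_field_cnj mult_minus_left)
  with assms[of "- field_cnj s"] show ?thesis by simp
qed

lemma linear_functional_scalar_rep:
  fixes u :: "'k::{real_normed_field,euclidean_space} \<Rightarrow> real"
  assumes "linear u"
  shows "\<exists>b. \<forall>x. u x = (x * b) \<bullet> 1"
proof (intro exI allI)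
  fix x
  have "u x = u (\<Sum>b\<in>Basis. (x \<bullet> b) *\<^sub>R b)" by (simp only: euclidean_representation)
  also have "\<dots> = x \<bullet> (\<Sum>b\<in>Basis. u b *\<^sub>R b)"
    by (simp add: linear_sum[OF assms] linear_scale[OF assms] inner_sum_right mult.commute)
  finally show "u x = (x * field_cnj (\<Sum>b\<in>Basis. u b *\<^sub>R b)) \<bullet> 1"
    by (simp only: inner_field_cnj)
qed


section \<open>Dominated linear functionals\<close>

definition sublinear :: "('v::real_vector \<Rightarrow> real) \<Rightarrow> bool" where
  "sublinear q \<longleftrightarrow> (\<forall>x y. q (x + y) \<le> q x + q y) \<and> (\<forall>x. \<forall>t\<ge>0. q (t *\<^sub>R x) = t * q x)"

lemma sublinearI:
  assumes "q 0 = 0"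
    and add: "\<And>x y. q (x + y) \<le> q x + q y"
    and scale: "\<And>x t. t > 0 \<Longrightarrow> q (t *\<^sub>R x) \<le> t * q x"
  shows "sublinear q"
proof -
  have "q (t *\<^sub>R x) = t * q x" if "t \<ge> 0" for x t
  proof (cases "t = 0")
    case False
    then have t: "t > 0" using that by simp
    have "t * q x = t * q ((1/t) *\<^sub>R (t *\<^sub>R x))" using t by simp
    also have "\<dots> \<le> t * ((1/t) * q (t *\<^sub>R x))"
      using t scale[of "1/t" "t *\<^sub>R x"] by (intro mult_left_mono) auto
    also have "\<dots> = q (t *\<^sub>R x)" using t by simp
    finally show ?thesis using scale[OF t, of x] by simp
  qed (simp add: assms)
  with add show ?thesis by (simp add: sublinear_def)
qed

lemma sublinear_add: "sublinear q \<Longrightarrow> q (x + y) \<le> q x + q y"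
  and sublinear_scale: "sublinear q \<Longrightarrow> t \<ge> 0 \<Longrightarrow> q (t *\<^sub>R x) = t * q x"
  by (auto simp: sublinear_def)

lemma sublinear_0: "sublinear q \<Longrightarrow> q 0 = 0"
  using sublinear_scale[of q 0 0] by simp

lemma sublinear_uminus: "sublinear q \<Longrightarrow> - q (- x) \<le> q x"
  using sublinear_add[of q x "- x"] sublinear_0[of q] by simp

lemma linear_if_sublinear_odd:
  assumes q: "sublinear q" and odd: "\<And>x. q (- x) \<le> - q x"
  shows "linear q"
proof -
  have m: "q (- x) = - q x" for x
    using odd[of x] sublinear_uminus[OF q, of x] by linarith
  show ?thesis
  proof (rule linearI)
    show "q (x + y) = q x + q y" for x y
      using sublinear_add[OF q, of x y] sublinear_add[OF q, of "x + y" "- y"] m[of y] by simp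
    show "q (t *\<^sub>R x) = t *\<^sub>R q x" for t x
    proof (cases "t \<ge> 0")
      case False
      then have "q (- (t *\<^sub>R x)) = - t * q x"
        using sublinear_scale[OF q, of "- t" x] by simp
      then show ?thesis using m[of "t *\<^sub>R x"] by simp
    qed (simp add: sublinear_scale[OF q])
  qed
qed

text \<open>Lower bounds on a cone are built into the sublinear functional itself: a linear f below
  \<open>s\<close> is below \<open>q\<close>, and \<open>f (- v) \<le> s (- v) \<le> - b\<close>
  says that f is at least \<open>b\<close> at \<open>v\<close>. The domination hypothesis bounds the
  infimum below by \<open>- q (- x)\<close>.\<close>

lemma sublinear_INF_cone:
  fixes q :: "'v::real_vector \<Rightarrow> real"
  assumes q: "sublinear q" and C: "convex_cone C" and dom: "\<And>v b. (v, b) \<in> C \<Longrightarrow> b \<le> q v"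
  defines "s \<equiv> \<lambda>x. INF (v, b)\<in>C. q (x + v) - b"
  shows "sublinear s" and "s x \<le> q x" and "(v, b) \<in> C \<Longrightarrow> s (- v) \<le> - b"
proof -
  have C0: "(0, 0) \<in> C" using C by (simp add: convex_cone_iff zero_prod_def)
  have lower: "- q (- x) \<le> q (x + v) - b" if "(v, b) \<in> C" for x v b
    using dom[OF that] sublinear_add[OF q, of "x + v" "- x"] by simp
  have bdd: "bdd_below ((\<lambda>(v, b). q (x + v) - b) ` C)" for x
    using lower by (intro bdd_belowI[of _ "- q (- x)"]) auto
  have s_le: "s x \<le> q (x + v) - b" if "(v, b) \<in> C" for x v b
    unfolding s_def using cINF_lower[OF bdd that] by simp
  have s_ge: "z \<le> s x" if "\<And>v b. (v, b) \<in> C \<Longrightarrow> z \<le> q (x + v) - b" for x z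
    unfolding s_def using C0 that by (intro cINF_greatest) auto
  show le: "s x \<le> q x" for x using s_le[OF C0, of x] by simp
  show "s (- v) \<le> - b" if "(v, b) \<in> C" using s_le[OF that, of "- v"] sublinear_0[OF q] by simp
  show "sublinear s"
  proof (rule sublinearI)
    show "s 0 = 0"
      using le[of 0] s_ge[of 0 0] dom sublinear_0[OF q] by (auto intro!: antisym)
    show "s (x + y) \<le> s x + s y" for x y
    proof -
      have "s (x + y) - s y \<le> q (x + v) - b" if vb: "(v, b) \<in> C" for v b
      proof -
        have "s (x + y) - (q (x + v) - b) \<le> q (y + w) - d" if wd: "(w, d) \<in> C" for w d
        proof -
          have "(v + w, b + d) \<in> C" using convex_cone_add[OF C vb wd] by simp
          from s_le[OF this, of "x + y"] sublinear_add[OF q, of "x + v" "y + w"] show ?thesis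
            by (simp add: ac_simps)
        qed
        from s_ge[OF this] show ?thesis by (simp add: algebra_simps)
      qed
      from s_ge[OF this] show ?thesis by simp
    qed
    show "s (t *\<^sub>R x) \<le> t * s x" if t: "t > 0" for x t
    proof -
      have "s (t *\<^sub>R x) / t \<le> q (x + v) - b" if vb: "(v, b) \<in> C" for v b
      proof -
        have "(t *\<^sub>R v, t * b) \<in> C" using convex_cone_scaleR[OF C _ vb, of t] t by simp
        from s_le[OF this, of "t *\<^sub>R x"] sublinear_scale[OF q, of t "x + v"] t show ?thesis
          by (simp add: scaleR_add_right field_simps)
      qed
      from s_ge[OF this] t show ?thesis by (simp add: field_simps)
    qed
  qed
qed

text \<open>Provides the lower bounds of chains that Zorn's lemma asks for.\<close>

lemma sublinear_INF_chain:
  fixes q :: "'v::real_vector \<Rightarrow> real"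
  assumes q: "sublinear q" and ne: "C \<noteq> {}"
    and sub: "\<And>s. s \<in> C \<Longrightarrow> sublinear s \<and> s \<le> q"
    and chain: "\<And>s s'. s \<in> C \<Longrightarrow> s' \<in> C \<Longrightarrow> s \<le> s' \<or> s' \<le> s"
  defines "r \<equiv> \<lambda>x. INF s\<in>C. s x"
  shows "sublinear r" and "s \<in> C \<Longrightarrow> r \<le> s"
proof -
  have bdd: "bdd_below ((\<lambda>s. s x) ` C)" for x
  proof (rule bdd_belowI2[where m = "- q (- x)"])
    show "- q (- x) \<le> s x" if "s \<in> C" for s
    proof -
      have "s (- x) \<le> q (- x)" using sub[OF that] by (simp add: le_fun_def)
      moreover have "- s (- x) \<le> s x" using sub[OF that] by (blast intro: sublinear_uminus)
      ultimately show ?thesis by linarith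
    qed
  qed
  have r_le: "r x \<le> s x" if "s \<in> C" for s x
    unfolding r_def by (rule cINF_lower[OF bdd that])
  have r_ge: "z \<le> r x" if "\<And>s. s \<in> C \<Longrightarrow> z \<le> s x" for z x
    unfolding r_def using ne that by (intro cINF_greatest) auto
  show "r \<le> s" if "s \<in> C" using r_le[OF that] by (simp add: le_fun_def)
  show "sublinear r"
  proof (rule sublinearI)
    show "r 0 = 0"
    proof -
      have "s 0 = 0" if "s \<in> C" for s using sub[OF that] sublinear_0 by blast
      then have "(INF s\<in>C. s 0) = (INF s\<in>C. 0)" by (intro INF_cong) auto
      then show ?thesis using ne by (simp add: r_def)
    qed
    show "r (x + y) \<le> r x + r y" for x y
    proof -
      have *: "r (x + y) \<le> s x + s' y" if s: "s \<in> C" "s' \<in> C" for s s'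
      proof -
        \<comment> \<open>Only here is the chain condition essential: subadditivity mixes two
          members, and the smaller of them serves for both.\<close>
        obtain m where m: "m \<in> C" "m \<le> s" "m \<le> s'" using chain[OF s] s by blast
        have "r (x + y) \<le> m (x + y)" by (rule r_le[OF m(1)])
        also have "\<dots> \<le> m x + m y" using sub[OF m(1)] by (blast intro: sublinear_add)
        also have "\<dots> \<le> s x + s' y" using m by (intro add_mono) (auto simp: le_fun_def)
        finally show ?thesis .
      qed
      have "r (x + y) - r y \<le> s x" if s: "s \<in> C" for s
      proof -
        have "r (x + y) - s x \<le> r y" using *[OF s] by (intro r_ge) (simp add: algebra_simps)
        then show ?thesis by simp
      qed
      then have "r (x + y) - r y \<le> r x" by (intro r_ge)
      then show ?thesis by simp
    qed
    show "r (t *\<^sub>R x) \<le> t * r x" if t: "t > 0" for x t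
    proof -
      have "r (t *\<^sub>R x) / t \<le> s x" if s: "s \<in> C" for s
        using r_le[OF s, of "t *\<^sub>R x"] sub[OF s] sublinear_scale[of s t x] t
        by (simp add: field_simps)
      then have "r (t *\<^sub>R x) / t \<le> r x" by (intro r_ge)
      with t show ?thesis by (simp add: field_simps)
    qed
  qed
qed

text \<open>A ray as cone prescribes a lower bound at a single vector.\<close>

lemma convex_cone_ray:
  fixes z :: "'v::real_vector"
  shows "convex_cone {t *\<^sub>R z |t. 0 \<le> t}"
  unfolding convex_cone_iff
proof (intro conjI ballI allI impI)
  show "0 \<in> {t *\<^sub>R z |t. 0 \<le> t}" by (auto intro: exI[of _ 0])
  show "x + y \<in> {t *\<^sub>R z |t. 0 \<le> t}" if "x \<in> {t *\<^sub>R z |t. 0 \<le> t}" "y \<in> {t *\<^sub>R z |t. 0 \<le> t}" for x y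
    using that by (auto simp flip: scaleR_add_left)
  show "c *\<^sub>R x \<in> {t *\<^sub>R z |t. 0 \<le> t}" if "x \<in> {t *\<^sub>R z |t. 0 \<le> t}" "0 \<le> c" for c x
    using that by auto
qed

text \<open>A minimal sublinear functional is linear.\<close>

lemma hahn_banach_sublinear:
  fixes q :: "'v::real_vector \<Rightarrow> real"
  assumes q: "sublinear q"
  shows "\<exists>f. linear f \<and> (\<forall>x. f x \<le> q x)"
proof -
  define A where "A = {s :: 'v \<Rightarrow> real. sublinear s \<and> s \<le> q}"
  have "\<exists>m\<in>A. \<forall>a\<in>A. m \<ge> a \<longrightarrow> a = m"
  proof (rule predicate_Zorn)
    show "partial_order_on A (relation_of (\<ge>) A)"
      by (rule partial_order_on_relation_ofI) auto
    fix C assume C: "C \<in> Chains (relation_of (\<ge>) A)"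
    then have sub: "sublinear s \<and> s \<le> q" if "s \<in> C" for s
      using that by (auto simp: Chains_def relation_of_def A_def)
    have chain: "s \<le> s' \<or> s' \<le> s" if "s \<in> C" "s' \<in> C" for s s'
      using that C by (auto simp: Chains_def relation_of_def)
    show "\<exists>u\<in>A. \<forall>a\<in>C. a \<ge> u"
    proof (cases "C = {}")
      case True
      then show ?thesis using q by (auto simp: A_def)
    next
      case False
      then obtain s where s: "s \<in> C" by blast
      have "(\<lambda>x. INF s\<in>C. s x) \<le> q"
        using sublinear_INF_chain(2)[OF q False sub chain s] sub[OF s] by (meson order_trans)
      then show ?thesis
        using sublinear_INF_chain[OF q False sub chain]
        by (intro bexI[where x="\<lambda>x. INF s\<in>C. s x"]) (auto simp: A_def)
    qed
  qed
  then obtain m where m: "sublinear m" "m \<le> q"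
    and min: "\<And>s. sublinear s \<Longrightarrow> s \<le> m \<Longrightarrow> s = m"
    unfolding A_def by (metis (mono_tags, lifting) mem_Collect_eq order_trans)
  have "m (- y) \<le> - m y" for y
  proof -
    \<comment> \<open>Forcing the lower bound \<open>m y\<close> at \<open>y\<close> gives a
      sublinear functional below \<open>m\<close>, hence \<open>m\<close> itself by minimality; its
      value at \<open>- y\<close> is then at most \<open>- m y\<close>.\<close>
    define C where "C = {t *\<^sub>R (y, m y) |t. 0 \<le> t}"
    have C: "convex_cone C" unfolding C_def by (rule convex_cone_ray)
    have dom: "b \<le> m v" if "(v, b) \<in> C" for v b
      using that by (auto simp: C_def sublinear_scale[OF m(1)])
    have y: "(y, m y) \<in> C" unfolding C_def by (auto intro!: exI[of _ 1])
    note I = sublinear_INF_cone[OF m(1) C dom]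
    define s where "s = (\<lambda>x. INF (v, b)\<in>C. m (x + v) - b)"
    have "s \<le> m" unfolding le_fun_def s_def by (intro allI I(2))
    with I(1) have "s = m" unfolding s_def by (intro min)
    moreover have "s (- y) \<le> - m y" unfolding s_def by (rule I(3)[OF _ y])
    ultimately show ?thesis by simp
  qed
  then have "linear m" by (rule linear_if_sublinear_odd[OF m(1)])
  with m(2) show ?thesis by (auto simp: le_fun_def)
qed

text \<open>Any linear functional below the modified functional of \<open>sublinear_INF_cone\<close>
  satisfies both kinds of bounds.\<close>

lemma mazur_orlicz:
  fixes q :: "'v::real_vector \<Rightarrow> real"
  assumes q: "sublinear q" and C: "convex_cone C" and dom: "\<And>v b. (v, b) \<in> C \<Longrightarrow> b \<le> q v"
  shows "\<exists>f. linear f \<and> (\<forall>x. f x \<le> q x) \<and> (\<forall>(v, b)\<in>C. b \<le> f v)"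
proof -
  note I = sublinear_INF_cone[OF q C dom]
  obtain f where f: "linear f" "\<And>x. f x \<le> (INF (v, b)\<in>C. q (x + v) - b)"
    using hahn_banach_sublinear[OF I(1)] by blast
  have "f x \<le> q x" for x using f(2)[of x] I(2)[of x] by (meson order_trans)
  moreover have "b \<le> f v" if vb: "(v, b) \<in> C" for v b
  proof -
    have "f (- v) \<le> - b" using f(2)[of "- v"] I(3)[OF _ vb] by (meson order_trans)
    then show ?thesis using linear_neg[OF f(1), of v] by simp
  qed
  ultimately show ?thesis using f(1) by blast
qed


section \<open>Finitely many coordinates\<close>

text \<open>Makes sequences of scalars a real vector space, so that the results on sublinear
  functionals apply. Tuples of varying length \<open>n\<close> are sequences of which only the first
  \<open>n\<close> entries matter.\<close>

instantiation "fun" :: (type, real_vector) real_vector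
begin

definition scaleR_fun_def: "r *\<^sub>R f = (\<lambda>x. r *\<^sub>R f x)"

instance
  by standard (simp_all add: scaleR_fun_def fun_eq_iff scaleR_add_right scaleR_add_left)

end

lemma scaleR_fun_apply [simp]: "(r *\<^sub>R f) x = r *\<^sub>R f x"
  by (simp add: scaleR_fun_def)

lemma sum_fun_apply: "(\<Sum>i\<in>A. f i) x = (\<Sum>i\<in>A. f i x)"
  by (induction A rule: infinite_finite_induct) auto

lemma linear_functional_coordinates:
  fixes f :: "(nat \<Rightarrow> 'v::real_vector) \<Rightarrow> real"
  assumes f: "linear f" and supp: "\<And>v. (\<And>i. i < n \<Longrightarrow> v i = 0) \<Longrightarrow> f v = 0"
  shows "f v = (\<Sum>i<n. f (\<lambda>j. if j = i then v i else 0))"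
proof -
  define w where "w = (\<Sum>i<n. (\<lambda>j. if j = i then v i else 0))"
  have "w j = (if j < n then v j else 0)" for j
    by (simp add: w_def sum_fun_apply)
  then have "f (v - w) = 0" by (intro supp) simp
  then have "f v = f w" by (simp add: linear_diff[OF f])
  also have "f w = (\<Sum>i<n. f (\<lambda>j. if j = i then v i else 0))"
    unfolding w_def by (rule linear_sum[OF f])
  finally show ?thesis .
qed

text \<open>A linear functional below the maximum of the first \<open>n\<close> coordinates is a
  probability vector: negative unit vectors give nonnegative weights, and the constants 1 and -1
  give total mass 1. The hypothesis says that this maximum is nonnegative on the cone, so the
  functional can be kept nonnegative there.\<close>

lemma finite_minimax:
  fixes C :: "(nat \<Rightarrow> real) set"
  assumes n: "n > 0" and C: "convex_cone C" and nonneg: "\<And>v. v \<in> C \<Longrightarrow> \<exists>j<n. 0 \<le> v j"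
  shows "\<exists>w. (\<forall>j<n. 0 \<le> w j) \<and> (\<Sum>j<n. w j) = 1 \<and> (\<forall>v\<in>C. 0 \<le> (\<Sum>j<n. v j * w j))"
proof -
  define q where "q v = Max (v ` {..<n})" for v :: "nat \<Rightarrow> real"
  have ne: "{..<n} \<noteq> {}" using n by auto
  have q_ge: "v j \<le> q v" if "j < n" for v j
    unfolding q_def using that by simp
  have q_le: "q v \<le> z" if "\<And>j. j < n \<Longrightarrow> v j \<le> z" for v z
    unfolding q_def using that n by (simp add: ne)
  have "q 0 = 0"
    using n q_le[of 0 0] q_ge[of 0 0] by auto
  have sub: "sublinear q"
  proof (rule sublinearI)
    show "q 0 = 0" by fact
    show "q (x + y) \<le> q x + q y" for x y
      by (intro q_le) (simp add: add_mono q_ge)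
    show "q (t *\<^sub>R x) \<le> t * q x" if "t > 0" for x t
      using that by (intro q_le) (simp add: q_ge)
  qed
  \<comment> \<open>The second component prescribes the lower bound 0 at every point of the
    cone.\<close>
  have "convex_cone (C \<times> {0::real})"
    using C by (auto simp: convex_cone_iff zero_prod_def)
  moreover have "b \<le> q v" if "(v, b) \<in> C \<times> {0}" for v b
    using that nonneg[of v] q_ge by (auto intro: order_trans)
  ultimately have "\<exists>f. linear f \<and> (\<forall>x. f x \<le> q x) \<and> (\<forall>(v, b)\<in>C \<times> {0}. b \<le> f v)"
    by (rule mazur_orlicz[OF sub])
  then obtain f where f: "linear f" and fq: "\<And>v. f v \<le> q v" and fC: "\<And>v. v \<in> C \<Longrightarrow> 0 \<le> f v"
    by auto
  have supp: "f v = 0" if "\<And>i. i < n \<Longrightarrow> v i = 0" for v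
  proof -
    have "q v \<le> 0" "q (- v) \<le> 0" using that by (auto intro!: q_le)
    then show ?thesis using fq[of v] fq[of "- v"] linear_neg[OF f, of v] by simp
  qed
  define w where "w i = f (\<lambda>j. if j = i then 1 else 0)" for i :: nat
  have f_eq: "f v = (\<Sum>i<n. v i * w i)" for v
  proof -
    have "f (\<lambda>j. if j = i then v i else 0) = v i * w i" for i
    proof -
      have "(\<lambda>j. if j = i then v i else 0) = v i *\<^sub>R (\<lambda>j. if j = i then 1 else (0::real))"
        by (auto simp: fun_eq_iff)
      then show ?thesis by (simp only: linear_scale[OF f] w_def real_scaleR_def)
    qed
    then show ?thesis
      using linear_functional_coordinates[OF f, of n v] supp by simp
  qed
  show ?thesis
  proof (intro exI[of _ w] conjI allI impI ballI)
    show "0 \<le> w j" if "j < n" for j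
    proof -
      have "f (- (\<lambda>i. if i = j then 1 else 0)) \<le> 0"
        by (rule order_trans[OF fq]) (auto intro!: q_le)
      then show ?thesis by (simp add: linear_neg[OF f] w_def)
    qed
    have "(\<Sum>j<n. w j) \<le> 1"
      using fq[of "\<lambda>_. 1"] q_le[of "\<lambda>_. 1" 1] f_eq[of "\<lambda>_. 1"] by simp
    moreover have "- (\<Sum>j<n. w j) \<le> - 1"
      using fq[of "\<lambda>_. -1"] q_le[of "\<lambda>_. -1" "-1"] f_eq[of "\<lambda>_. -1"] by (simp add: sum_negf)
    ultimately show "(\<Sum>j<n. w j) = 1" by simp
    show "0 \<le> (\<Sum>j<n. v j * w j)" if "v \<in> C" for v
      using fC[of v] that f_eq[of v] by simp
  qed
qed

text \<open>Every real-linear functional of finitely many scalars is \<open>\<xi> \<mapsto> (\<Sum>i. \<xi> i * \<beta> i) \<bullet> 1\<close>.\<close>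

lemma mazur_orlicz_scalars:
  fixes q :: "(nat \<Rightarrow> 'k::{real_normed_field,euclidean_space}) \<Rightarrow> real"
  assumes add: "\<And>x y. q (\<lambda>i. x i + y i) \<le> q x + q y"
    and scale: "\<And>c x. q (\<lambda>i. c * x i) = norm c * q x"
    and supp: "\<And>x. (\<And>i. i < n \<Longrightarrow> x i = 0) \<Longrightarrow> q x = 0"
    and C: "convex_cone C" and dom: "\<And>v b. (v, b) \<in> C \<Longrightarrow> b \<le> q v"
  shows "\<exists>\<beta>. (\<forall>x. norm (\<Sum>i<n. x i * \<beta> i) \<le> q x) \<and>
    (\<forall>v b. (v, b) \<in> C \<longrightarrow> b \<le> (\<Sum>i<n. v i * \<beta> i) \<bullet> 1)"
proof -
  have sub: "sublinear q"
  proof (rule sublinearI)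
    show "q 0 = 0" by (rule supp) simp
    show "q (x + y) \<le> q x + q y" for x y using add[of x y] by (simp add: plus_fun_def)
    show "q (t *\<^sub>R x) \<le> t * q x" if "t > 0" for x t
      using that scale[of "of_real t" x] by (simp add: scaleR_fun_def scaleR_conv_of_real)
  qed
  obtain f where f: "linear f" and fq: "\<And>v. f v \<le> q v" and fC: "\<And>v b. (v, b) \<in> C \<Longrightarrow> b \<le> f v"
    using mazur_orlicz[OF sub C dom] by blast
  have f0: "f v = 0" if "\<And>i. i < n \<Longrightarrow> v i = 0" for v
  proof -
    have "q v = 0" "q (- v) = 0" using that by (auto intro!: supp)
    then show ?thesis using fq[of v] fq[of "- v"] linear_neg[OF f, of v] by simp
  qed
  have "\<exists>b. \<forall>x. f (\<lambda>j. if j = i then x else 0) = (x * b) \<bullet> 1" for i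
  proof -
    have "linear (\<lambda>x j. if j = i then x else (0::'k))"
      by (intro linearI) (auto simp: fun_eq_iff)
    then have "linear (\<lambda>x. f (\<lambda>j. if j = i then x else 0))"
      using linear_compose[OF _ f] by (simp add: o_def)
    then show ?thesis by (rule linear_functional_scalar_rep)
  qed
  then obtain \<beta> where \<beta>: "\<And>i x. f (\<lambda>j. if j = i then x else 0) = (x * \<beta> i) \<bullet> 1"
    by metis
  have f_eq: "f v = (\<Sum>i<n. v i * \<beta> i) \<bullet> 1" for v
    using linear_functional_coordinates[OF f, of n v] f0 by (simp add: \<beta> inner_sum_left)
  show ?thesis
  proof (intro exI conjI allI)
    show "norm (\<Sum>i<n. x i * \<beta> i) \<le> q x" for x
    proof -
      define s where "s = (\<Sum>i<n. x i * \<beta> i)"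
      show ?thesis
      proof (cases "s = 0")
        case True
        have "q x = q (\<lambda>i. -1 * x i)" using scale[of "-1" x] by simp
        moreover have "(\<lambda>i. -1 * x i) = - x" by (auto simp: fun_eq_iff)
        ultimately have "0 \<le> q x" using fq[of x] fq[of "- x"] linear_neg[OF f, of x] by simp
        with True show ?thesis by (simp add: s_def)
      next
        case False
        \<comment> \<open>The unimodular scalar that rotates \<open>s\<close> onto its norm; the
          real bound at the rotated sequence bounds the norm.\<close>
        define c where "c = field_cnj s / of_real (norm s)"
        have "norm s = of_real (norm s) \<bullet> (1::'k)" by (simp only: inner_of_real_one)
        also have "of_real (norm s) = c * s"
          using False mult_field_cnj[of s] by (simp add: c_def power2_eq_square mult.commute)
        also have "\<dots> = (\<Sum>i<n. c * x i * \<beta> i)"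
          by (simp add: s_def sum_distrib_left mult.assoc)
        also have "\<dots> \<bullet> 1 = f (\<lambda>i. c * x i)" by (rule f_eq[symmetric])
        also have "\<dots> \<le> q (\<lambda>i. c * x i)" by (rule fq)
        also have "\<dots> = q x"
          unfolding scale using False by (simp add: c_def norm_divide norm_field_cnj)
        finally show ?thesis by (simp add: s_def)
      qed
    qed
    show "(v, b) \<in> C \<longrightarrow> b \<le> (\<Sum>i<n. v i * \<beta> i) \<bullet> 1" for v b
      using fC by (simp flip: f_eq)
  qed
qed


section \<open>Finite \<open>\<ell>\<^sub>p\<close> norms\<close>

definition psum :: "real \<Rightarrow> nat \<Rightarrow> (nat \<Rightarrow> 'a::real_normed_vector) \<Rightarrow> real" where
  "psum p n a = (\<Sum>i<n. norm (a i) powr p) powr (1 / p)"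

lemma psum_nonneg: "0 \<le> psum p n a"
  by (simp add: psum_def)

lemma psum_powr:
  assumes "1 \<le> p"
  shows "psum p n a powr p = (\<Sum>i<n. norm (a i) powr p)"
  using assms by (simp add: psum_def powr_powr sum_nonneg)

lemma psum_le_iff:
  assumes "1 \<le> p" "0 \<le> c"
  shows "psum p n a \<le> c \<longleftrightarrow> (\<Sum>i<n. norm (a i) powr p) \<le> c powr p"
proof
  show "psum p n a \<le> c \<Longrightarrow> (\<Sum>i<n. norm (a i) powr p) \<le> c powr p"
    using assms powr_mono2[of p "psum p n a" c] by (simp add: psum_nonneg psum_powr)
  show "psum p n a \<le> c" if "(\<Sum>i<n. norm (a i) powr p) \<le> c powr p"
    using assms powr_mono2[OF _ _ that, of "1/p"] by (simp add: psum_def powr_powr sum_nonneg)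
qed

lemma psum_mono:
  assumes "1 \<le> p" "\<And>i. i < n \<Longrightarrow> norm (a i) \<le> norm (b i)"
  shows "psum p n a \<le> psum p n b"
  unfolding psum_def using assms by (intro powr_mono2 sum_mono sum_nonneg) auto

lemma psum_cong: "(\<And>i. i < n \<Longrightarrow> norm (a i) = norm (b i)) \<Longrightarrow> psum p n a = psum p n b"
  by (simp add: psum_def)

lemma psum_eq_0:
  assumes "\<And>i. i < n \<Longrightarrow> a i = 0"
  shows "psum p n a = 0"
  using assms by (simp add: psum_def)

lemma psum_eq_0_imp:
  assumes "1 \<le> p" "psum p n a = 0" "i < n"
  shows "a i = 0"
proof -
  have "(\<Sum>i<n. norm (a i) powr p) = 0" using assms psum_powr[of p n a] by simp
  then show ?thesis using assms by (simp add: sum_nonneg_eq_0_iff)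
qed

lemma psum_mult:
  fixes a :: "nat \<Rightarrow> 'k::real_normed_field"
  assumes "1 \<le> p"
  shows "psum p n (\<lambda>i. c * a i) = norm c * psum p n a"
  using assms by (simp add: psum_def norm_mult powr_mult powr_powr sum_nonneg flip: sum_distrib_left)

text \<open>When an argument vanishes, the claim reduces to \<open>s powr p \<le> s\<close> for
  \<open>s\<close> in [0,1]; otherwise it is convexity on the positive reals.\<close>

lemma powr_convex_nonneg:
  fixes t x y p :: real
  assumes p: "1 \<le> p" and t: "0 \<le> t" "t \<le> 1" and xy: "0 \<le> x" "0 \<le> y"
  shows "(t * x + (1 - t) * y) powr p \<le> t * x powr p + (1 - t) * y powr p"
proof -
  have *: "(s * z) powr p \<le> s * z powr p" if "0 \<le> s" "s \<le> 1" "0 \<le> z" for s z :: real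
  proof (cases "s = 0")
    case False
    then have "s powr p \<le> s powr 1" using that p by (intro powr_mono') auto
    then show ?thesis using that by (simp add: powr_mult mult_right_mono)
  qed simp
  consider "x = 0" | "y = 0" | "x > 0" "y > 0" using xy by linarith
  then show ?thesis
  proof cases
    case 1 then show ?thesis using *[of "1 - t" y] t xy by simp
  next
    case 2 then show ?thesis using *[of t x] t xy by simp
  next
    case 3
    then show ?thesis
      using convex_onD[OF powr_convex[OF p], of "1 - t" x y] t by (simp add: algebra_simps)
  qed
qed

text \<open>Minkowski's inequality from convexity: after division by the p-sums \<open>A\<close> and
  \<open>B\<close>, the bound \<open>norm (a i) + norm (b i)\<close> is \<open>A + B\<close> times a
  convex combination of the normalized terms, with weight \<open>A / (A + B)\<close>.\<close>

lemma psum_triangle: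
  assumes p: "1 \<le> p"
  shows "psum p n (\<lambda>i. a i + b i) \<le> psum p n a + psum p n b"
proof -
  define A where "A = psum p n a"
  define B where "B = psum p n b"
  consider "A = 0" | "B = 0" | "A > 0" "B > 0"
    using psum_nonneg[of p n a] psum_nonneg[of p n b] by (force simp: A_def B_def)
  then show ?thesis
  proof cases
    case 1
    then have "psum p n (\<lambda>i. a i + b i) = psum p n b"
      using psum_eq_0_imp[OF p, of n a] by (intro psum_cong) (auto simp: A_def)
    then show ?thesis using psum_nonneg[of p n a] by simp
  next
    case 2
    then have "psum p n (\<lambda>i. a i + b i) = psum p n a"
      using psum_eq_0_imp[OF p, of n b] by (intro psum_cong) (auto simp: B_def)
    then show ?thesis using psum_nonneg[of p n b] by simp
  next
    case 3
    define t where "t = A / (A + B)"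
    have t: "0 \<le> t" "t \<le> 1" "(A + B) * t = A" "(A + B) * (1 - t) = B"
      using 3 by (auto simp: t_def field_simps)
    have "norm (a i + b i) powr p
        \<le> (A + B) powr p * (t * (norm (a i) powr p / A powr p) + (1 - t) * (norm (b i) powr p / B powr p))"
      for i
    proof -
      have "norm (a i + b i) \<le> norm (a i) + norm (b i)" by (rule norm_triangle_ineq)
      also have "\<dots> = ((A + B) * t) * (norm (a i) / A) + ((A + B) * (1 - t)) * (norm (b i) / B)"
        unfolding t(3,4) using 3 by simp
      also have "\<dots> = (A + B) * (t * (norm (a i) / A) + (1 - t) * (norm (b i) / B))"
        by (simp only: distrib_left mult.assoc)
      finally have "norm (a i + b i) powr p \<le> \<dots> powr p" using p by (intro powr_mono2) auto
      also have "\<dots> = (A + B) powr p * (t * (norm (a i) / A) + (1 - t) * (norm (b i) / B)) powr p"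
        using 3 t by (intro powr_mult)
      also have "\<dots> \<le> (A + B) powr p * (t * (norm (a i) / A) powr p + (1 - t) * (norm (b i) / B) powr p)"
        using 3 t p by (intro mult_left_mono powr_convex_nonneg) auto
      finally show ?thesis using 3 by (simp add: powr_divide)
    qed
    then have "(\<Sum>i<n. norm (a i + b i) powr p)
        \<le> (\<Sum>i<n. (A + B) powr p * (t * (norm (a i) powr p / A powr p) + (1 - t) * (norm (b i) powr p / B powr p)))"
      by (intro sum_mono)
    also have "\<dots> = (A + B) powr p * (t * ((\<Sum>i<n. norm (a i) powr p) / A powr p)
        + (1 - t) * ((\<Sum>i<n. norm (b i) powr p) / B powr p))"
      by (simp only: sum.distrib sum_divide_distrib[symmetric] sum_distrib_left[symmetric])
    also have "\<dots> = (A + B) powr p"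
      unfolding psum_powr[OF p, symmetric] using 3 by (simp add: A_def B_def)
    finally show ?thesis
      using p 3 by (simp add: psum_le_iff A_def B_def)
  qed
qed

section \<open>Duality between finite p-sums and conjugate sequences\<close>

lemma mazur_orlicz_psum:
  fixes C :: "((nat \<Rightarrow> 'k::{real_normed_field,euclidean_space}) \<times> real) set"
  assumes p: "1 \<le> p" and C: "convex_cone C" and dom: "\<And>v b. (v, b) \<in> C \<Longrightarrow> b \<le> psum p n v"
  shows "\<exists>\<beta>. (\<forall>x. norm (\<Sum>i<n. x i * \<beta> i) \<le> psum p n x) \<and>
    (\<forall>v b. (v, b) \<in> C \<longrightarrow> b \<le> (\<Sum>i<n. v i * \<beta> i) \<bullet> 1)"
  by (rule mazur_orlicz_scalars)
    (use p C dom in \<open>simp_all add: psum_triangle psum_mult psum_eq_0\<close>)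

text \<open>For p > 1, Young's inequality is applied termwise after dividing \<open>a\<close> by its
  p-sum.\<close>

lemma holder_conj_ball:
  fixes a \<alpha> :: "nat \<Rightarrow> 'k::{real_normed_field,euclidean_space}"
  assumes p: "1 \<le> p" and \<alpha>: "\<alpha> \<in> conj_ball p"
  shows "norm (\<Sum>i<n. \<alpha> i * a i) \<le> psum p n a"
proof (cases "p = 1")
  case True
  have "norm (\<Sum>i<n. \<alpha> i * a i) \<le> (\<Sum>i<n. norm (a i))"
    using \<alpha> True
    by (intro sum_norm_le) (auto simp: conj_ball_def norm_mult intro!: mult_left_le_one_le)
  then show ?thesis by (simp add: psum_def True sum_nonneg)
next
  case False
  define q where "q = p / (p - 1)"
  have pq: "p > 1" "q > 1" "1 / p + 1 / q = 1" using p False by (auto simp: q_def field_simps)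
  have \<alpha>': "summable (\<lambda>i. norm (\<alpha> i) powr q)" "(\<Sum>i. norm (\<alpha> i) powr q) powr (1 / q) \<le> 1"
    using \<alpha> False
    by (auto simp: conj_ball_def lp_space_def lp_norm_def whole_nspace_def subspace_nspace_def q_def)
  have "(\<Sum>i<n. norm (\<alpha> i) powr q) \<le> (\<Sum>i. norm (\<alpha> i) powr q)"
    using \<alpha>'(1) by (intro sum_le_suminf) auto
  also have "\<dots> \<le> 1"
    using powr_mono2[OF _ _ \<alpha>'(2), of q] pq by (simp add: powr_powr suminf_nonneg \<alpha>'(1))
  finally have \<alpha>1: "(\<Sum>i<n. norm (\<alpha> i) powr q) \<le> 1" .
  define A where "A = psum p n a"
  show ?thesis
  proof (cases "A = 0")
    case True
    then have "(\<Sum>i<n. \<alpha> i * a i) = 0"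
      using psum_eq_0_imp[OF p] by (intro sum.neutral) (auto simp: A_def)
    then show ?thesis by (simp add: psum_nonneg)
  next
    case False
    then have A: "A > 0" using psum_nonneg[of p n a] by (simp add: A_def)
    have "norm (\<Sum>i<n. \<alpha> i * a i) \<le> (\<Sum>i<n. A * (norm (\<alpha> i) powr q / q + (norm (a i) / A) powr p / p))"
    proof (intro sum_norm_le)
      fix i
      have "norm (\<alpha> i * a i) = A * (norm (\<alpha> i) * (norm (a i) / A))" using A by (simp add: norm_mult)
      also have "\<dots> \<le> A * (norm (\<alpha> i) powr q / q + (norm (a i) / A) powr p / p)"
        using A pq by (intro mult_left_mono Youngs_inequality) auto
      finally show "norm (\<alpha> i * a i) \<le> A * (norm (\<alpha> i) powr q / q + (norm (a i) / A) powr p / p)" .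
    qed
    also have "\<dots> = A * ((\<Sum>i<n. norm (\<alpha> i) powr q) / q + ((\<Sum>i<n. norm (a i) powr p) / A powr p) / p)"
      using A by (simp add: powr_divide sum.distrib sum_divide_distrib flip: sum_distrib_left)
    also have "(\<Sum>i<n. norm (a i) powr p) / A powr p = 1"
      unfolding psum_powr[OF p, symmetric] using A by (simp add: A_def)
    also have "A * ((\<Sum>i<n. norm (\<alpha> i) powr q) / q + 1 / p) \<le> A * (1 / q + 1 / p)"
      using A \<alpha>1 pq by (intro mult_left_mono add_mono divide_right_mono) auto
    also have "\<dots> = A" using pq by simp
    finally show ?thesis by (simp add: A_def)
  qed
qed

text \<open>Converse of Hoelder's inequality: coefficients obtained from
  \<open>mazur_orlicz_psum\<close> are admissible in \<open>p_co\<close> once they are padded with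
  zeros.\<close>

lemma conj_ball_if_dominated:
  fixes \<beta> :: "nat \<Rightarrow> 'k::{real_normed_field,euclidean_space}"
  assumes p: "1 \<le> p" and le: "\<And>x. norm (\<Sum>i<n. x i * \<beta> i) \<le> psum p n x"
  shows "(\<lambda>i. if i < n then \<beta> i else 0) \<in> conj_ball p" (is "?\<alpha> \<in> _")
proof (cases "p = 1")
  case True
  have "norm (\<beta> j) \<le> 1" if "j < n" for j
  proof -
    have "(\<Sum>i<n. (if i = j then 1 else 0) * \<beta> i) = (\<Sum>i<n. if i = j then \<beta> j else 0)"
      by (intro sum.cong) auto
    moreover have "psum p n (\<lambda>i. if i = j then 1 else 0 :: 'k) = (\<Sum>i<n. if i = j then 1 else 0)"
      unfolding psum_def True by (simp add: sum_nonneg if_distrib[of norm] cong: if_cong)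
    ultimately show ?thesis using le[of "\<lambda>i. if i = j then 1 else 0"] that by simp
  qed
  moreover have "?\<alpha> \<longlonglongrightarrow> 0"
    by (rule tendsto_eventually) (auto intro!: eventually_sequentiallyI[of n])
  ultimately show ?thesis by (simp add: conj_ball_def True)
next
  case False
  define q where "q = p / (p - 1)"
  have pq: "p > 1" "q > 1" "(q - 1) * p = q" using p False by (auto simp: q_def field_simps)
  define S where "S = (\<Sum>i<n. norm (\<beta> i) powr q)"
  have S0: "S \<ge> 0" by (simp add: S_def sum_nonneg)
  \<comment> \<open>The extremal sequence of Hoelder's inequality: \<open>x i * \<beta> i\<close>
    and \<open>norm (x i) powr p\<close> both equal \<open>norm (\<beta> i) powr q\<close>, so the
    hypothesis reads \<open>S \<le> S powr (1 / p)\<close>, which excludes S > 1.\<close>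
  define x where "x i = of_real (norm (\<beta> i) powr (q - 2)) * field_cnj (\<beta> i)" for i
  have "x i * \<beta> i = of_real (norm (\<beta> i) powr q)" for i
  proof (cases "\<beta> i = 0")
    case False
    have "norm (\<beta> i) powr q = norm (\<beta> i) powr (q - 2) * (norm (\<beta> i))\<^sup>2"
      using False by (simp add: powr_diff powr_numeral)
    then show ?thesis using mult_field_cnj[of "\<beta> i"] by (simp add: x_def ac_simps)
  qed simp
  then have "norm (\<Sum>i<n. x i * \<beta> i) = S"
    using S0 by (simp add: S_def flip: of_real_sum)
  moreover have "norm (x i) powr p = norm (\<beta> i) powr q" for i
  proof (cases "\<beta> i = 0")
    case False
    have "norm (x i) = norm (\<beta> i) powr (q - 2) * norm (\<beta> i) powr 1"
      by (simp add: x_def norm_mult norm_field_cnj)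
    also have "\<dots> = norm (\<beta> i) powr (q - 1)" using powr_add[of "norm (\<beta> i)" "q - 2" 1] by simp
    finally show ?thesis by (simp add: powr_powr pq)
  qed (simp add: x_def field_cnj_def)
  then have "psum p n x = S powr (1 / p)" by (simp add: psum_def S_def)
  ultimately have SS: "S \<le> S powr (1 / p)" using le[of x] by simp
  have "S \<le> 1"
  proof (rule ccontr)
    assume "\<not> S \<le> 1"
    then have "S powr (1 / p) < S powr 1" using pq by (intro powr_less_mono) auto
    with SS S0 show False by simp
  qed
  have 0: "norm (?\<alpha> i) powr q = 0" if "i \<notin> {..<n}" for i
    using that by simp
  have "summable (\<lambda>i. norm (?\<alpha> i) powr q)"
    by (rule summable_finite[of "{..<n}"]) (use 0 in auto)
  moreover have "(\<Sum>i. norm (?\<alpha> i) powr q) = S"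
    using 0 by (subst suminf_finite[of "{..<n}"]) (auto simp: S_def)
  moreover have "S powr (1 / q) \<le> 1" using S0 \<open>S \<le> 1\<close> pq by (simp add: powr_le1)
  ultimately show ?thesis
    using False
    by (simp add: conj_ball_def lp_space_def lp_norm_def whole_nspace_def subspace_nspace_def
        flip: q_def)
qed


section \<open>Duals\<close>

text \<open>The fragment of the normed space axioms that makes the supremum in
  \<open>dual_nspace\<close> an operator norm; a nonempty ball keeps that supremum off the empty
  set. The fragment passes to duals, so one set of lemmas serves a space, its dual and its
  bidual.\<close>

definition homogeneous_nspace :: "('k::real_normed_field, 'a) nspace \<Rightarrow> bool" where
  "homogeneous_nspace X \<longleftrightarrow> unit_ball X \<noteq> {} \<and> (\<forall>x\<in>carrier X. 0 \<le> nrm X x) \<and>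
     (\<forall>c. \<forall>x\<in>carrier X. smult X c x \<in> carrier X \<and> nrm X (smult X c x) = norm c * nrm X x)"

lemma dual_nspace_simps [simp]:
  "carrier (dual_nspace X) = bounded_ops X (whole_nspace (*)) \<inter> extensional (carrier X)"
  "add (dual_nspace X) f g = (\<lambda>x\<in>carrier X. f x + g x)"
  "zero (dual_nspace X) = (\<lambda>x\<in>carrier X. 0)"
  "smult (dual_nspace X) c f = (\<lambda>x\<in>carrier X. c * f x)"
  "nrm (dual_nspace X) f = (SUP x\<in>unit_ball X. norm (f x))"
  by (simp_all add: dual_nspace_def)

lemma whole_nspace_simps [simp]:
  "carrier (whole_nspace s) = UNIV"
  "add (whole_nspace s) = (+)"
  "zero (whole_nspace s) = 0"
  "smult (whole_nspace s) = s"
  "nrm (whole_nspace s) = norm"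
  by (simp_all add: whole_nspace_def subspace_nspace_def)

lemma bounded_functional_iff:
  "f \<in> bounded_ops X (whole_nspace (*)) \<longleftrightarrow>
     (\<forall>x\<in>carrier X. \<forall>y\<in>carrier X. f (add X x y) = f x + f y) \<and>
     (\<forall>c. \<forall>x\<in>carrier X. f (smult X c x) = c * f x) \<and>
     (\<exists>C. \<forall>x\<in>carrier X. norm (f x) \<le> C * nrm X x)"
  by (simp add: bounded_ops_def)

lemma bdd_above_functional:
  assumes X: "homogeneous_nspace X" and f: "f \<in> bounded_ops X (whole_nspace (*))"
  shows "bdd_above ((\<lambda>x. norm (f x)) ` unit_ball X)"
proof -
  obtain C where C: "\<And>x. x \<in> carrier X \<Longrightarrow> norm (f x) \<le> C * nrm X x"
    using f unfolding bounded_functional_iff by blast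
  have "norm (f x) \<le> \<bar>C\<bar>" if "x \<in> unit_ball X" for x
  proof -
    have x: "x \<in> carrier X" "nrm X x \<le> 1" using that by (auto simp: unit_ball_def)
    have "0 \<le> nrm X x" using X x(1) by (simp add: homogeneous_nspace_def)
    then have "C * nrm X x \<le> \<bar>C\<bar> * 1"
      using x(2) by (intro mult_mono) auto
    with C[OF x(1)] show ?thesis by simp
  qed
  then show ?thesis by (intro bdd_aboveI[of _ "\<bar>C\<bar>"]) auto
qed

lemma functional_le_nrm:
  assumes X: "homogeneous_nspace X" and f: "f \<in> carrier (dual_nspace X)" and x: "x \<in> carrier X"
  shows "norm (f x) \<le> nrm (dual_nspace X) f * nrm X x"
proof -
  have f': "f \<in> bounded_ops X (whole_nspace (*))" using f by simp
  show ?thesis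
  proof (cases "nrm X x = 0")
    case True
    then show ?thesis using f' x unfolding bounded_functional_iff by fastforce
  next
    case False
    then have pos: "nrm X x > 0" using X x by (auto simp: homogeneous_nspace_def less_le)
    define z where "z = smult X (of_real (1 / nrm X x)) x"
    have z: "z \<in> unit_ball X" using X x pos by (simp add: homogeneous_nspace_def unit_ball_def z_def norm_divide)
    have "norm (f z) = norm (f x) / nrm X x"
      using f' x pos unfolding bounded_functional_iff by (simp add: z_def norm_mult norm_divide)
    moreover have "norm (f z) \<le> nrm (dual_nspace X) f"
      unfolding dual_nspace_simps by (rule cSUP_upper[OF z bdd_above_functional[OF X f']])
    ultimately show ?thesis using pos by (simp add: pos_divide_le_eq)
  qed
qed

lemma nrm_dual_le:
  assumes "homogeneous_nspace X" "\<And>x. x \<in> unit_ball X \<Longrightarrow> norm (f x) \<le> C"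
  shows "nrm (dual_nspace X) f \<le> C"
  unfolding dual_nspace_simps using assms by (intro cSUP_least) (auto simp: homogeneous_nspace_def)

lemma nrm_dual_nonneg:
  assumes X: "homogeneous_nspace X" and f: "f \<in> carrier (dual_nspace X)"
  shows "0 \<le> nrm (dual_nspace X) f"
proof -
  obtain x where x: "x \<in> unit_ball X" using X by (auto simp: homogeneous_nspace_def)
  have "norm (f x) \<le> nrm (dual_nspace X) f"
    unfolding dual_nspace_simps using f by (intro cSUP_upper[OF x bdd_above_functional[OF X]]) simp
  then show ?thesis using norm_ge_zero order_trans by blast
qed

lemma homogeneous_dual_nspace:
  fixes X :: "('k::{real_normed_field,euclidean_space}, 'a) nspace"
  assumes X: "homogeneous_nspace X"
    and add: "\<And>x y. x \<in> carrier X \<Longrightarrow> y \<in> carrier X \<Longrightarrow> add X x y \<in> carrier X"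
  shows "homogeneous_nspace (dual_nspace X)"
proof -
  have smult_closed: "smult X c x \<in> carrier X" if "x \<in> carrier X" for c x
    using X that by (simp add: homogeneous_nspace_def)
  have closed: "smult (dual_nspace X) c f \<in> carrier (dual_nspace X)"
    if f: "f \<in> carrier (dual_nspace X)" for c f
  proof -
    obtain C where C: "\<And>x. x \<in> carrier X \<Longrightarrow> norm (f x) \<le> C * nrm X x"
      using f unfolding dual_nspace_simps Int_iff bounded_functional_iff by blast
    have "norm (c * f x) \<le> (norm c * C) * nrm X x" if "x \<in> carrier X" for x
      using mult_left_mono[OF C[OF that], of "norm c"] by (simp add: norm_mult mult.assoc)
    with f show ?thesis
      by (auto simp: bounded_functional_iff add smult_closed algebra_simps intro!: exI[of _ "norm c * C"])
  qed
  have le: "nrm (dual_nspace X) (smult (dual_nspace X) c f) \<le> norm c * nrm (dual_nspace X) f"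
    if f: "f \<in> carrier (dual_nspace X)" for c f
  proof (rule nrm_dual_le[OF X])
    fix x assume x: "x \<in> unit_ball X"
    then have "norm (f x) \<le> nrm (dual_nspace X) f"
      unfolding dual_nspace_simps using f by (intro cSUP_upper[OF x bdd_above_functional[OF X]]) simp
    then show "norm (smult (dual_nspace X) c f x) \<le> norm c * nrm (dual_nspace X) f"
      using x unfolding dual_nspace_simps by (simp add: unit_ball_def norm_mult mult_left_mono)
  qed
  have "nrm (dual_nspace X) (smult (dual_nspace X) c f) = norm c * nrm (dual_nspace X) f"
    if f: "f \<in> carrier (dual_nspace X)" for c f
  proof (cases "c = 0")
    case True
    then show ?thesis
      using le[OF f, of c] nrm_dual_nonneg[OF X closed[OF f, of c]] by simp
  next
    case False
    have "smult (dual_nspace X) (1 / c) (smult (dual_nspace X) c f) = f"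
      using f False by (auto simp: fun_eq_iff extensional_def)
    then have "nrm (dual_nspace X) f \<le> norm (1 / c) * nrm (dual_nspace X) (smult (dual_nspace X) c f)"
      using le[OF closed[OF f, of c], of "1 / c"] by metis
    then show ?thesis using le[OF f, of c] False by (simp add: norm_divide field_simps)
  qed
  moreover have "(\<lambda>x\<in>carrier X. 0) \<in> unit_ball (dual_nspace X)"
  proof -
    have "(\<lambda>x\<in>carrier X. 0) \<in> carrier (dual_nspace X)"
      by (auto simp: bounded_functional_iff add smult_closed intro!: exI[of _ 0])
    moreover have "nrm (dual_nspace X) (\<lambda>x\<in>carrier X. 0) \<le> 1"
      by (rule nrm_dual_le[OF X]) (simp add: unit_ball_def)
    ultimately show ?thesis by (simp add: unit_ball_def)
  qed
  ultimately show ?thesis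
    using closed nrm_dual_nonneg[OF X] unfolding homogeneous_nspace_def by blast
qed

lemma homogeneous_nspaceD:
  assumes "homogeneous_nspace X" "x \<in> carrier X"
  shows "0 \<le> nrm X x" "smult X c x \<in> carrier X" "nrm X (smult X c x) = norm c * nrm X x"
  using assms by (auto simp: homogeneous_nspace_def)

context normed_space_over
begin

abbreviation dual :: "('k, 'a \<Rightarrow> 'k) nspace" where
  "dual \<equiv> dual_nspace (whole_nspace scale)"

lemma scale_minus_one: "scale (- 1) x = - x"
  using scale_minus_left[of 1 x] by simp

lemma homogeneous_whole: "homogeneous_nspace (whole_nspace scale)"
  by (auto simp: homogeneous_nspace_def unit_ball_def norm_scale intro: exI[of _ 0])

lemma homogeneous_dual: "homogeneous_nspace dual"
  by (rule homogeneous_dual_nspace[OF homogeneous_whole]) simp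

lemma dual_iff:
  "f \<in> carrier dual \<longleftrightarrow> (\<forall>x y. f (x + y) = f x + f y) \<and> (\<forall>c x. f (scale c x) = c * f x) \<and>
     (\<exists>C. \<forall>x. norm (f x) \<le> C * norm x)"
  by (simp add: bounded_functional_iff)

context
  fixes f assumes f: "f \<in> carrier dual"
begin

lemma dual_add: "f (x + y) = f x + f y"
  and dual_scale: "f (scale c x) = c * f x"
  using f unfolding dual_iff by blast+

lemma dual_scaleR: "f (r *\<^sub>R x) = of_real r * f x"
  by (simp add: dual_scale flip: scale_of_real)

lemma dual_0: "f 0 = 0"
  using dual_scale[of 0 0] by simp

lemma dual_minus: "f (- x) = - f x"
  using dual_scale[of "- 1" x] by (simp add: scale_minus_one)

lemma dual_diff: "f (x - y) = f x - f y"
  using dual_add[of x "- y"] by (simp add: dual_minus)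

lemma dual_sum: "f (\<Sum>i\<in>A. x i) = (\<Sum>i\<in>A. f (x i))"
  by (induction A rule: infinite_finite_induct) (auto simp: dual_0 dual_add)

lemma dual_le: "norm (f x) \<le> nrm dual f * norm x"
  using functional_le_nrm[OF homogeneous_whole f, of x] by simp

lemma dual_nonneg: "0 \<le> nrm dual f"
  by (rule nrm_dual_nonneg[OF homogeneous_whole f])

end

declare dual_nspace_simps [simp del]

lemma dual_nrm_le: "(\<And>x. norm x \<le> 1 \<Longrightarrow> norm (f x) \<le> C) \<Longrightarrow> nrm dual f \<le> C"
  by (rule nrm_dual_le[OF homogeneous_whole]) (simp add: unit_ball_def)

lemma dual_cmult: "f \<in> carrier dual \<Longrightarrow> (\<lambda>x. c * f x) \<in> carrier dual"
  using homogeneous_nspaceD(2)[OF homogeneous_dual, of f c] by (simp add: dual_nspace_simps(4) restrict_UNIV)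

lemma dual_plus:
  assumes f: "f \<in> carrier dual" and g: "g \<in> carrier dual"
  shows "(\<lambda>x. f x + g x) \<in> carrier dual"
proof -
  have "norm (f x + g x) \<le> (nrm dual f + nrm dual g) * norm x" for x
    using norm_triangle_ineq[of "f x" "g x"] dual_le[OF f, of x] dual_le[OF g, of x]
    by (simp add: distrib_right)
  then show ?thesis
    unfolding dual_iff
    by (intro conjI exI[of _ "nrm dual f + nrm dual g"])
      (simp_all add: dual_add[OF f] dual_add[OF g] dual_scale[OF f] dual_scale[OF g] algebra_simps)
qed

lemma dual_zero: "(\<lambda>x. 0) \<in> carrier dual"
  unfolding dual_iff by (auto intro: exI[of _ 0])

lemma dual_combination:
  fixes m :: nat
  assumes "\<And>i. i < m \<Longrightarrow> f i \<in> carrier dual"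
  shows "(\<lambda>x. \<Sum>i<m. f i x * \<beta> i) \<in> carrier dual"
  using assms
proof (induction m)
  case (Suc m)
  then show ?case using dual_plus[OF _ dual_cmult[of "f m" "\<beta> m"]] by (simp add: mult.commute)
qed (simp add: dual_zero)

section \<open>The bidual and weak p-sums\<close>

lemma bidual_add:
  assumes "\<phi> \<in> carrier (dual_nspace dual)" "f \<in> carrier dual" "g \<in> carrier dual"
  shows "\<phi> (\<lambda>x. f x + g x) = \<phi> f + \<phi> g"
  using assms unfolding dual_nspace_simps(1)[of dual] Int_iff bounded_functional_iff
  by (auto simp: dual_nspace_simps(2) restrict_UNIV)

lemma bidual_cmult:
  assumes "\<phi> \<in> carrier (dual_nspace dual)" "f \<in> carrier dual"
  shows "\<phi> (\<lambda>x. c * f x) = c * \<phi> f"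
  using assms unfolding dual_nspace_simps(1)[of dual] Int_iff bounded_functional_iff
  by (auto simp: dual_nspace_simps(4) restrict_UNIV)

lemma bidual_combination:
  fixes m :: nat
  assumes \<phi>: "\<phi> \<in> carrier (dual_nspace dual)" and f: "\<And>i. i < m \<Longrightarrow> f i \<in> carrier dual"
  shows "\<phi> (\<lambda>x. \<Sum>i<m. f i x * \<beta> i) = (\<Sum>i<m. \<phi> (f i) * \<beta> i)"
  using f
proof (induction m)
  case 0
  then show ?case using bidual_cmult[OF \<phi> dual_zero, of 0] by simp
next
  case (Suc m)
  then have "\<phi> (\<lambda>x. (\<Sum>i<m. f i x * \<beta> i) + \<beta> m * f m x) = \<phi> (\<lambda>x. \<Sum>i<m. f i x * \<beta> i) + \<beta> m * \<phi> (f m)"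
    by (simp add: bidual_add[OF \<phi>] dual_combination dual_cmult bidual_cmult[OF \<phi>])
  with Suc show ?case by (simp add: mult.commute)
qed

lemma bidual_le:
  assumes "\<phi> \<in> unit_ball (dual_nspace dual)" "f \<in> carrier dual"
  shows "norm (\<phi> f) \<le> nrm dual f"
proof -
  have "norm (\<phi> f) \<le> nrm (dual_nspace dual) \<phi> * nrm dual f"
    using assms by (intro functional_le_nrm[OF homogeneous_dual]) (auto simp: unit_ball_def)
  also have "\<dots> \<le> 1 * nrm dual f"
    using assms by (intro mult_right_mono dual_nonneg) (auto simp: unit_ball_def)
  finally show ?thesis by simp
qed

text \<open>The canonical image of \<open>y\<close> in the bidual; it shows that the supremum over
  the ball of the space is at most the one over the bidual ball.\<close>

lemma bidual_evaluation:
  assumes y: "norm y \<le> 1"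
  shows "(\<lambda>f\<in>carrier dual. f y) \<in> unit_ball (dual_nspace dual)"
proof -
  have "(\<lambda>x. f x + g x) \<in> carrier dual" if "f \<in> carrier dual" "g \<in> carrier dual" for f g
    using that by (rule dual_plus)
  moreover have le: "norm (f y) \<le> 1 * nrm dual f" if "f \<in> carrier dual" for f
    using dual_le[OF that, of y] mult_left_mono[OF y dual_nonneg[OF that]] by simp
  ultimately have "(\<lambda>f\<in>carrier dual. f y) \<in> carrier (dual_nspace dual)"
    unfolding dual_nspace_simps(1)[of dual] Int_iff bounded_functional_iff
    using dual_cmult
    by (intro conjI exI[of _ 1]) (auto simp: dual_nspace_simps(2,4) restrict_UNIV)
  moreover have "nrm (dual_nspace dual) (\<lambda>f\<in>carrier dual. f y) \<le> 1"
  proof (rule nrm_dual_le[OF homogeneous_dual])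
    fix f assume "f \<in> unit_ball dual"
    then show "norm ((\<lambda>f\<in>carrier dual. f y) f) \<le> 1"
      using le[of f] by (auto simp: unit_ball_def)
  qed
  ultimately show ?thesis by (simp add: unit_ball_def)
qed

abbreviation weak_psum :: "real \<Rightarrow> nat \<Rightarrow> (nat \<Rightarrow> 'a \<Rightarrow> 'k) \<Rightarrow> real" where
  "weak_psum p m f \<equiv> SUP \<phi>\<in>unit_ball (dual_nspace dual). psum p m (\<lambda>i. \<phi> (f i))"

lemma bdd_above_weak_psum:
  assumes p: "1 \<le> p" and f: "\<And>i. i < m \<Longrightarrow> f i \<in> carrier dual"
  shows "bdd_above ((\<lambda>\<phi>. psum p m (\<lambda>i. \<phi> (f i))) ` unit_ball (dual_nspace dual))"
proof (rule bdd_aboveI2)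
  fix \<phi> assume "\<phi> \<in> unit_ball (dual_nspace dual)"
  then show "psum p m (\<lambda>i. \<phi> (f i)) \<le> psum p m (\<lambda>i. nrm dual (f i))"
    using bidual_le f by (intro psum_mono[OF p]) (simp add: order_trans[OF _ abs_ge_self])
qed

lemma psum_le_weak_psum:
  assumes p: "1 \<le> p" and f: "\<And>i. i < m \<Longrightarrow> f i \<in> carrier dual" and y: "norm y \<le> 1"
  shows "psum p m (\<lambda>i. f i y) \<le> weak_psum p m f"
proof -
  have "psum p m (\<lambda>i. f i y) = psum p m (\<lambda>i. (\<lambda>f\<in>carrier dual. f y) (f i))"
    using f by (intro psum_cong) auto
  also have "\<dots> \<le> weak_psum p m f"
    using p f by (intro cSUP_upper bidual_evaluation y bdd_above_weak_psum) auto
  finally show ?thesis .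
qed

lemma weak_psum_nonneg:
  assumes p: "1 \<le> p" and f: "\<And>i. i < m \<Longrightarrow> f i \<in> carrier dual"
  shows "0 \<le> weak_psum p m f"
proof -
  have "0 \<le> psum p m (\<lambda>i. f i 0)" by (rule psum_nonneg)
  also have "\<dots> \<le> weak_psum p m f" using p f by (intro psum_le_weak_psum) auto
  finally show ?thesis .
qed

text \<open>The bidual ball may be replaced by the ball of the space itself, with no appeal to Goldstine's
  theorem: a norming functional on \<open>\<ell>\<^sub>p\<close> turns the left-hand side into the norm of one functional.\<close>

lemma weak_psum_le:
  assumes p: "1 \<le> p" and f: "\<And>i. i < m \<Longrightarrow> f i \<in> carrier dual"
    and s: "\<And>y. norm y \<le> 1 \<Longrightarrow> psum p m (\<lambda>i. f i y) \<le> s"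
  shows "weak_psum p m f \<le> s"
proof (rule cSUP_least)
  show "unit_ball (dual_nspace dual) \<noteq> {}" using bidual_evaluation[of 0] by auto
  fix \<phi> assume \<phi>: "\<phi> \<in> unit_ball (dual_nspace dual)"
  then have \<phi>': "\<phi> \<in> carrier (dual_nspace dual)" by (simp add: unit_ball_def)
  define a where "a i = \<phi> (f i)" for i
  \<comment> \<open>The ray through \<open>a\<close> with value \<open>psum p m a\<close> makes
    \<open>\<beta>\<close> a norming functional of \<open>a\<close>. Contracting the
    \<open>f i\<close> with \<open>\<beta>\<close> gives one functional \<open>g\<close>, which is
    at most \<open>s\<close> in norm because \<open>\<beta>\<close> is dominated by the
    p-sum.\<close>
  define C where "C = {t *\<^sub>R (a, psum p m a) |t. 0 \<le> t}"
  have dom: "b \<le> psum p m v" if "(v, b) \<in> C" for v b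
  proof -
    from that obtain t where t: "0 \<le> t" "v = t *\<^sub>R a" "b = t * psum p m a" by (auto simp: C_def)
    have "t *\<^sub>R a = (\<lambda>i. of_real t * a i)" by (simp add: fun_eq_iff scaleR_conv_of_real)
    with t show ?thesis using psum_mult[OF p, of m "of_real t" a] by simp
  qed
  have cone: "convex_cone C" unfolding C_def by (rule convex_cone_ray)
  obtain \<beta> where \<beta>: "\<And>x. norm (\<Sum>i<m. x i * \<beta> i) \<le> psum p m x"
      and \<beta>C: "\<And>v b. (v, b) \<in> C \<Longrightarrow> b \<le> (\<Sum>i<m. v i * \<beta> i) \<bullet> 1"
    using mazur_orlicz_psum[OF p cone dom] by blast
  define g where "g = (\<lambda>x. \<Sum>i<m. f i x * \<beta> i)"
  have g: "g \<in> carrier dual" unfolding g_def by (rule dual_combination[OF f])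
  have "(a, psum p m a) \<in> C" unfolding C_def by (auto intro!: exI[of _ 1])
  from \<beta>C[OF this] have "psum p m a \<le> (\<Sum>i<m. a i * \<beta> i) \<bullet> 1" .
  also have "\<dots> \<le> norm (\<Sum>i<m. a i * \<beta> i)" by (rule inner_one_le_norm)
  also have "(\<Sum>i<m. a i * \<beta> i) = \<phi> g" unfolding a_def g_def by (rule bidual_combination[OF \<phi>' f, symmetric])
  also have "norm (\<phi> g) \<le> nrm dual g" by (rule bidual_le[OF \<phi> g])
  also have "\<dots> \<le> s" unfolding g_def by (intro dual_nrm_le order_trans[OF \<beta> s])
  finally show "psum p m (\<lambda>i. \<phi> (f i)) \<le> s" by (simp add: a_def)
qed

end


section \<open>Quotients\<close>

lemma subspace_nspace_simps [simp]:
  "carrier (subspace_nspace s M) = M"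
  "nrm (subspace_nspace s M) = norm"
  by (simp_all add: subspace_nspace_def)

lemma quotient_nspace_simps:
  "carrier (quotient_nspace s L) = range (coset L)"
  "add (quotient_nspace s L) A B = {a + b |a b. a \<in> A \<and> b \<in> B}"
  "zero (quotient_nspace s L) = L"
  "smult (quotient_nspace s L) c A = {s c a + l |a l. a \<in> A \<and> l \<in> L}"
  "nrm (quotient_nspace s L) A = (INF a\<in>A. norm a)"
  by (simp_all add: quotient_nspace_def)

context normed_space_over
begin

lemma mem_coset_iff: "z \<in> coset L y \<longleftrightarrow> z - y \<in> L"
  by (auto simp: coset_def image_iff algebra_simps intro: bexI[of _ "z - y"])

context
  fixes L assumes L: "subspace L"
begin

lemma quotient_add:
  "add (quotient_nspace scale L) (coset L x) (coset L y) = coset L (x + y)"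
proof (intro set_eqI iffI)
  fix z assume "z \<in> add (quotient_nspace scale L) (coset L x) (coset L y)"
  then obtain a b where "z = a + b" "a - x \<in> L" "b - y \<in> L"
    by (auto simp: quotient_nspace_simps mem_coset_iff)
  then show "z \<in> coset L (x + y)"
    using subspace_add[OF L, of "a - x" "b - y"] by (simp add: mem_coset_iff algebra_simps)
next
  fix z assume "z \<in> coset L (x + y)"
  then have "x \<in> coset L x" "z - x \<in> coset L y"
    using subspace_0[OF L] by (auto simp: mem_coset_iff algebra_simps)
  moreover have "z = x + (z - x)" by simp
  ultimately show "z \<in> add (quotient_nspace scale L) (coset L x) (coset L y)"
    unfolding quotient_nspace_simps by blast
qed

lemma quotient_smult: "smult (quotient_nspace scale L) c (coset L x) = coset L (scale c x)"
proof (intro set_eqI iffI)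
  fix z assume "z \<in> smult (quotient_nspace scale L) c (coset L x)"
  then obtain a l where al: "z = scale c a + l" "a - x \<in> L" "l \<in> L"
    by (auto simp: quotient_nspace_simps mem_coset_iff)
  have "scale c (a - x) + l \<in> L" by (intro subspace_add[OF L] subspace_scale[OF L] al)
  then show "z \<in> coset L (scale c x)"
    by (simp add: al mem_coset_iff scale_right_diff_distrib algebra_simps)
next
  fix z assume "z \<in> coset L (scale c x)"
  then have "z = scale c x + (z - scale c x)" "x \<in> coset L x" "z - scale c x \<in> L"
    using subspace_0[OF L] by (auto simp: mem_coset_iff)
  then show "z \<in> smult (quotient_nspace scale L) c (coset L x)"
    unfolding quotient_nspace_simps by blast
qed

lemma quotient_nrm_le:
  assumes "l \<in> L"
  shows "nrm (quotient_nspace scale L) (coset L x) \<le> norm (x + l)"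
  unfolding quotient_nspace_simps
  by (rule cINF_lower) (auto simp: mem_coset_iff assms intro: bdd_belowI[of _ 0])

lemma quotient_nrm_greatest:
  assumes "\<And>l. l \<in> L \<Longrightarrow> z \<le> norm (x + l)"
  shows "z \<le> nrm (quotient_nspace scale L) (coset L x)"
  unfolding quotient_nspace_simps
proof (rule cINF_greatest)
  show "coset L x \<noteq> {}" using subspace_0[OF L] by (auto simp: coset_def)
  show "z \<le> norm a" if "a \<in> coset L x" for a
    using assms[of "a - x"] that by (simp add: mem_coset_iff)
qed

lemma quotient_nrm_nonneg: "0 \<le> nrm (quotient_nspace scale L) (coset L x)"
  by (rule quotient_nrm_greatest) simp

lemma quotient_nrm_le_norm: "nrm (quotient_nspace scale L) (coset L x) \<le> norm x"
  using quotient_nrm_le[OF subspace_0[OF L], of x] by simp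

lemma quotient_nrm_eq_0: "x \<in> L \<Longrightarrow> nrm (quotient_nspace scale L) (coset L x) = 0"
  using quotient_nrm_le[of "- x" x] quotient_nrm_nonneg[of x] subspace_neg[OF L, of x] by simp

lemma partial_sum_quotient:
  "partial_sum (quotient_nspace scale L) (\<lambda>n. coset L (w n)) n = coset L (\<Sum>i<n. w i)"
proof (induction n)
  case 0
  show ?case by (simp add: quotient_nspace_simps coset_def)
qed (simp add: quotient_add add.commute)

lemma sums_in_quotient_iff:
  "sums_in (quotient_nspace scale L) (\<lambda>n. smult (quotient_nspace scale L) (\<alpha> n) (coset L (w n))) (coset L v)
    \<longleftrightarrow> (\<lambda>n. nrm (quotient_nspace scale L) (coset L ((\<Sum>i<n. scale (\<alpha> i) (w i)) - v))) \<longlonglongrightarrow> 0"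
  by (simp add: sums_in_def quotient_smult partial_sum_quotient quotient_add quotient_nspace_simps(1)
      scale_minus_one)

text \<open>A homogeneous function invariant under \<open>L\<close> descends to the quotient, so its
  bound on the unit ball applies to every representative and hence to the infimum of their norms. It
  is used for the norm of one functional and for the p-sum of several.\<close>

lemma annihilator_seminorm_le:
  assumes h: "\<And>c x. h (scale c x) = norm c * h x" and L0: "\<And>l x. l \<in> L \<Longrightarrow> h (x + l) = h x"
    and s: "\<And>y. norm y \<le> 1 \<Longrightarrow> h y \<le> s"
  shows "h x \<le> s * nrm (quotient_nspace scale L) (coset L x)"
proof -
  have hs: "h y \<le> s * norm y" for y
  proof (cases "y = 0")
    case True
    then show ?thesis using h[of 0 0] by simp
  next
    case False
    have "h (scale (of_real (1 / norm y)) y) \<le> s"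
      using False by (intro s) (simp add: norm_scale norm_divide)
    then show ?thesis unfolding h using False by (simp add: norm_divide field_simps)
  qed
  have "0 \<le> s" using s[of 0] h[of 0 0] by simp
  show ?thesis
  proof (cases "s = 0")
    case True
    then show ?thesis using hs[of x] by simp
  next
    case False
    have "h x / s \<le> nrm (quotient_nspace scale L) (coset L x)"
    proof (rule quotient_nrm_greatest)
      fix l assume "l \<in> L"
      then show "h x / s \<le> norm (x + l)"
        using hs[of "x + l"] L0[of l x] \<open>0 \<le> s\<close> False by (simp add: field_simps)
    qed
    then show ?thesis using \<open>0 \<le> s\<close> False by (simp add: field_simps)
  qed
qed

lemma annihilator_le:
  assumes f: "f \<in> carrier dual" and fL: "\<And>l. l \<in> L \<Longrightarrow> f l = 0"
  shows "norm (f x) \<le> nrm dual f * nrm (quotient_nspace scale L) (coset L x)"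
proof (rule annihilator_seminorm_le)
  show "norm (f y) \<le> nrm dual f" if "norm y \<le> 1" for y
    using dual_le[OF f, of y] mult_left_mono[OF that dual_nonneg[OF f]] by simp
qed (simp_all add: dual_scale[OF f] dual_add[OF f] fL norm_mult)

end

lemma bounded_linear_dual:
  assumes f: "f \<in> carrier dual"
  shows "bounded_linear f"
proof (rule bounded_linear_intro[where K = "nrm dual f"])
  show "norm (f x) \<le> norm x * nrm dual f" for x
    using dual_le[OF f, of x] by (simp add: mult.commute)
qed (simp_all add: dual_add[OF f] dual_scaleR[OF f] scaleR_conv_of_real)

text \<open>Each further functional costs at most one extra spanning vector: a \<open>b\<close> in
  the previous kernel that it does not kill, by multiples of which every vector of that kernel can
  be corrected.\<close>

lemma kernel_closed_fin_codim:
  fixes f :: "nat \<Rightarrow> 'a \<Rightarrow> 'k" and m :: nat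
  assumes f: "\<And>i. i < m \<Longrightarrow> f i \<in> carrier dual"
  shows "{y. \<forall>i<m. f i y = 0} \<in> closed_fin_codim_subspaces scale"
proof -
  let ?L = "\<lambda>m. {y. \<forall>i<m. f i y = 0}"
  have closed: "closed (?L m)"
  proof -
    have "?L m = (\<Inter>i\<in>{..<m}. {y. f i y = 0})" by auto
    moreover have "closed {y. f i y = 0}" if "i < m" for i
      using that bounded_linear.continuous_on[OF bounded_linear_dual[OF f]]
      by (intro closed_Collect_eq continuous_on_const) (auto intro: continuous_on_id)
    ultimately show ?thesis by auto
  qed
  have sub: "subspace (?L k)" if "k \<le> m" for k
  proof (rule subspaceI)
    have fk: "f i \<in> carrier dual" if "i < k" for i using f that \<open>k \<le> m\<close> by simp
    show "0 \<in> ?L k" using dual_0[OF fk] by simp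
    show "x + y \<in> ?L k" if "x \<in> ?L k" "y \<in> ?L k" for x y using that dual_add[OF fk] by simp
    show "scale c x \<in> ?L k" if "x \<in> ?L k" for c x using that dual_scale[OF fk] by simp
  qed
  have "\<exists>B. finite B \<and> span (?L k \<union> B) = UNIV" if "k \<le> m" for k
    using that
  proof (induction k)
    case 0
    then show ?case by (intro exI[of _ "{}"]) simp
  next
    case (Suc k)
    then obtain B where B: "finite B" "span (?L k \<union> B) = UNIV" by auto
    have fk: "f k \<in> carrier dual" using f Suc.prems by simp
    show ?case
    proof (cases "\<exists>b\<in>?L k. f k b \<noteq> 0")
      case False
      then have "?L (Suc k) = ?L k" by (auto simp: less_Suc_eq)
      with B show ?thesis by auto
    next
      case True
      then obtain b where b: "b \<in> ?L k" "f k b \<noteq> 0" by blast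
      have "y \<in> span (?L (Suc k) \<union> insert b B)" if y: "y \<in> ?L k" for y
      proof -
        define c where "c = f k y / f k b"
        have "y - scale c b \<in> ?L k"
          using sub[of k] Suc.prems y b by (intro subspace_diff subspace_scale) auto
        moreover have "f k (y - scale c b) = 0"
          using b by (simp add: dual_diff[OF fk] dual_scale[OF fk] c_def)
        ultimately have "y - scale c b \<in> ?L (Suc k)" by (auto simp: less_Suc_eq)
        then have "(y - scale c b) + scale c b \<in> span (?L (Suc k) \<union> insert b B)"
          by (intro span_add span_scale span_base) auto
        then show ?thesis by simp
      qed
      then have "?L k \<union> B \<subseteq> span (?L (Suc k) \<union> insert b B)"
        by (auto intro: span_base)
      then have "span (?L k \<union> B) \<subseteq> span (?L (Suc k) \<union> insert b B)"
        by (rule span_minimal) (rule subspace_span)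
      with B show ?thesis by (intro exI[of _ "insert b B"]) auto
    qed
  qed
  with closed sub[of m] show ?thesis by (auto simp: closed_fin_codim_subspaces_def)
qed

end


section \<open>The adjoint\<close>

locale bounded_operator = E: normed_space_over sE + F: normed_space_over sF
  for sE :: "'k::{real_normed_field,euclidean_space} \<Rightarrow> 'a::real_normed_vector \<Rightarrow> 'a"
    and sF :: "'k \<Rightarrow> 'b::real_normed_vector \<Rightarrow> 'b" +
  fixes T :: "'a \<Rightarrow> 'b"
  assumes bounded: "T \<in> bounded_ops (whole_nspace sE) (whole_nspace sF)"
begin

lemma T_add: "T (x + y) = T x + T y"
  and T_scale: "T (sE c x) = sF c (T x)"
  using bounded by (simp_all add: bounded_ops_def)

lemma T_bound: obtains K where "K \<ge> 0" "\<And>x. norm (T x) \<le> K * norm x"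
proof -
  obtain K where "\<And>x. norm (T x) \<le> K * norm x" using bounded by (auto simp: bounded_ops_def)
  then have "norm (T x) \<le> \<bar>K\<bar> * norm x" for x
    by (meson abs_ge_self mult_right_mono norm_ge_zero order_trans)
  then show ?thesis using that[of "\<bar>K\<bar>"] by simp
qed

lemma norm_comp_le:
  assumes f: "f \<in> carrier F.dual" and K: "\<And>x. norm (T x) \<le> K * norm x"
  shows "norm (f (T x)) \<le> (nrm F.dual f * K) * norm x"
  using F.dual_le[OF f, of "T x"] mult_left_mono[OF K[of x] F.dual_nonneg[OF f]]
  by (simp add: mult.assoc)

lemma comp_dual: "f \<in> carrier F.dual \<Longrightarrow> (\<lambda>x. f (T x)) \<in> carrier E.dual"
proof -
  assume f: "f \<in> carrier F.dual"
  obtain K where "\<And>x. norm (T x) \<le> K * norm x" using T_bound by blast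
  from norm_comp_le[OF f this] show ?thesis
    unfolding E.dual_iff using F.dual_add[OF f] F.dual_scale[OF f]
    by (auto simp: T_add T_scale)
qed

lemma adjoint_op_eq:
  "f \<in> carrier F.dual \<Longrightarrow> adjoint_op (whole_nspace sE) (whole_nspace sF) T f = (\<lambda>x. f (T x))"
  by (simp add: adjoint_op_def restrict_UNIV)

lemma adjoint_bounded: "adjoint_op (whole_nspace sE) (whole_nspace sF) T \<in> bounded_ops F.dual E.dual"
proof -
  obtain K where K: "K \<ge> 0" "\<And>x. norm (T x) \<le> K * norm x" using T_bound by blast
  have "nrm E.dual (\<lambda>x. f (T x)) \<le> K * nrm F.dual f" if f: "f \<in> carrier F.dual" for f
  proof (rule E.dual_nrm_le)
    fix x :: 'a assume x: "norm x \<le> 1"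
    have "norm (f (T x)) \<le> (nrm F.dual f * K) * norm x" by (rule norm_comp_le[OF f K(2)])
    also have "\<dots> \<le> (nrm F.dual f * K) * 1"
      using x K F.dual_nonneg[OF f] by (intro mult_left_mono) auto
    finally show "norm (f (T x)) \<le> K * nrm F.dual f" by (simp add: mult.commute)
  qed
  moreover have "add F.dual f g = (\<lambda>x. f x + g x)" "smult F.dual c f = (\<lambda>x. c * f x)" for f g c
    by (simp_all add: dual_nspace_simps(2,4) restrict_UNIV)
  moreover have "add E.dual f g = (\<lambda>x. f x + g x)" "smult E.dual c f = (\<lambda>x. c * f x)" for f g c
    by (simp_all add: dual_nspace_simps(2,4) restrict_UNIV)
  ultimately show ?thesis
    unfolding bounded_ops_def
    by (auto simp: adjoint_op_eq comp_dual F.dual_plus F.dual_cmult)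
qed

lemma p_summing_bound_adjoint_iff:
  "p_summing_bound p F.dual E.dual (adjoint_op (whole_nspace sE) (whole_nspace sF) T) C \<longleftrightarrow>
     (\<forall>m f. (\<forall>i<m. f i \<in> carrier F.dual) \<longrightarrow>
        psum p m (\<lambda>i. nrm E.dual (\<lambda>x. f i (T x))) \<le> C * F.weak_psum p m f)"
proof -
  have "(\<Sum>i<m. nrm E.dual (adjoint_op (whole_nspace sE) (whole_nspace sF) T (f i)) powr p) powr (1 / p)
      = psum p m (\<lambda>i. nrm E.dual (\<lambda>x. f i (T x)))"
    if "\<forall>i<m. f i \<in> carrier F.dual" for m :: nat and f
    using that by (simp add: psum_def adjoint_op_eq E.dual_nonneg comp_dual)
  then show ?thesis unfolding p_summing_bound_def by (auto simp: psum_def)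
qed

end


section \<open>From compact quotients to summing adjoints\<close>

context bounded_operator
begin

text \<open>Everything is compared with the double series of \<open>norm (f i (w n)) powr p\<close>.
  For fixed \<open>i\<close>, Hoelder bounds the left-hand entry by the series over n
  (\<open>entry\<close>); for fixed n, the sum over \<open>i\<close> is bounded by the weak p-norm
  (\<open>row\<close>). The representatives \<open>w n\<close> are arbitrary, as the functionals
  vanish on \<open>L\<close>.\<close>

lemma psum_le_if_p_compact:
  assumes p: "1 \<le> p" and f: "\<And>i. i < m \<Longrightarrow> f i \<in> carrier F.dual"
    and x: "\<And>i. i < m \<Longrightarrow> x i \<in> unit_ball X"
    and L: "F.subspace L" and fL: "\<And>i l. i < m \<Longrightarrow> l \<in> L \<Longrightarrow> f i l = 0"
    and y: "y \<in> lp_space p (quotient_nspace sF L)"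
    and co: "(\<lambda>x. coset L (T x)) ` unit_ball X \<subseteq> p_co p (quotient_nspace sF L) y"
  shows "psum p m (\<lambda>i. f i (T (x i))) \<le> F.weak_psum p m f * lp_norm p (quotient_nspace sF L) y"
proof -
  let ?Q = "quotient_nspace sF L"
  have "y n \<in> range (coset L)" for n
    using y by (auto simp: lp_space_def quotient_nspace_simps(1))
  then have "\<forall>n. \<exists>w. y n = coset L w" by (auto simp: image_iff)
  then obtain w where w: "\<And>n. y n = coset L (w n)" by metis
  have y_sum: "summable (\<lambda>n. nrm ?Q (y n) powr p)" using y by (simp add: lp_space_def)
  have y0: "0 \<le> nrm ?Q (y n)" for n unfolding w by (rule F.quotient_nrm_nonneg[OF L])
  have f_le: "norm (f i v) \<le> nrm F.dual (f i) * nrm ?Q (coset L v)" if "i < m" for i v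
    using F.annihilator_le[OF L f fL] that by blast
  have summable: "summable (\<lambda>n. norm (f i (w n)) powr p)" if i: "i < m" for i
  proof (rule summable_comparison_test')
    show "summable (\<lambda>n. nrm F.dual (f i) powr p * nrm ?Q (y n) powr p)"
      by (intro summable_mult y_sum)
    show "norm (norm (f i (w n)) powr p) \<le> nrm F.dual (f i) powr p * nrm ?Q (y n) powr p" for n
    proof -
      have "norm (f i (w n)) powr p \<le> (nrm F.dual (f i) * nrm ?Q (y n)) powr p"
        using p f_le[OF i, of "w n"] by (intro powr_mono2) (auto simp: w)
      also have "\<dots> = nrm F.dual (f i) powr p * nrm ?Q (y n) powr p"
        using F.dual_nonneg[OF f[OF i]] y0 by (intro powr_mult)
      finally show ?thesis by simp
    qed
  qed
  have entry: "norm (f i (T (x i))) powr p \<le> (\<Sum>n. norm (f i (w n)) powr p)" if i: "i < m" for i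
  proof -
    have "coset L (T (x i)) \<in> p_co p ?Q y" using co x[OF i] by blast
    then obtain \<alpha> where \<alpha>: "\<alpha> \<in> conj_ball p"
      "sums_in ?Q (\<lambda>n. smult ?Q (\<alpha> n) (coset L (w n))) (coset L (T (x i)))"
      by (auto simp: p_co_def w)
    define r where "r n = (\<Sum>j<n. sF (\<alpha> j) (w j))" for n
    have "(\<lambda>n. nrm ?Q (coset L (r n - T (x i)))) \<longlonglongrightarrow> 0"
      using \<alpha>(2) unfolding F.sums_in_quotient_iff[OF L] r_def .
    then have "(\<lambda>n. nrm F.dual (f i) * nrm ?Q (coset L (r n - T (x i)))) \<longlonglongrightarrow> 0"
      by (rule tendsto_mult_right_zero)
    then have "(\<lambda>n. f i (r n - T (x i))) \<longlonglongrightarrow> 0"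
      by (rule Lim_null_comparison[rotated]) (simp add: f_le[OF i])
    then have "(\<lambda>n. f i (r n) - f i (T (x i))) \<longlonglongrightarrow> 0"
      by (simp add: F.dual_diff[OF f[OF i]])
    then have lim: "(\<lambda>n. norm (f i (r n))) \<longlonglongrightarrow> norm (f i (T (x i)))"
      by (intro tendsto_norm) (simp add: LIM_zero_iff)
    have "norm (f i (r n)) \<le> (\<Sum>n. norm (f i (w n)) powr p) powr (1 / p)" for n
    proof -
      have "f i (r n) = (\<Sum>j<n. \<alpha> j * f i (w j))"
        by (simp add: r_def F.dual_sum[OF f[OF i]] F.dual_scale[OF f[OF i]])
      also have "norm \<dots> \<le> psum p n (\<lambda>j. f i (w j))" by (rule holder_conj_ball[OF p \<alpha>(1)])
      also have "\<dots> \<le> (\<Sum>n. norm (f i (w n)) powr p) powr (1 / p)"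
        unfolding psum_def using p summable[OF i]
        by (intro powr_mono2 sum_le_suminf) (auto intro: sum_nonneg)
      finally show ?thesis .
    qed
    then have "norm (f i (T (x i))) \<le> (\<Sum>n. norm (f i (w n)) powr p) powr (1 / p)"
      by (intro LIMSEQ_le_const2[OF lim]) auto
    then have "norm (f i (T (x i))) powr p \<le> ((\<Sum>n. norm (f i (w n)) powr p) powr (1 / p)) powr p"
      using p by (intro powr_mono2) auto
    also have "\<dots> = (\<Sum>n. norm (f i (w n)) powr p)"
      using p summable[OF i] by (simp add: powr_powr suminf_nonneg)
    finally show ?thesis .
  qed
  let ?s = "F.weak_psum p m f"
  have s0: "0 \<le> ?s" by (rule F.weak_psum_nonneg[OF p f])
  \<comment> \<open>The p-sum of the functionals is invariant under \<open>L\<close>, so the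
    quotient norm of \<open>y n\<close> suffices here, although \<open>w n\<close> itself may have
    large norm.\<close>
  have row: "psum p m (\<lambda>i. f i (w n)) \<le> ?s * nrm ?Q (y n)" for n
    unfolding w
  proof (rule F.annihilator_seminorm_le[OF L])
    show "psum p m (\<lambda>i. f i (sF c v)) = norm c * psum p m (\<lambda>i. f i v)" for c v
      unfolding psum_mult[OF p, symmetric] by (intro psum_cong) (simp add: F.dual_scale[OF f])
    show "psum p m (\<lambda>i. f i (v + l)) = psum p m (\<lambda>i. f i v)" if "l \<in> L" for l v
      using that by (intro psum_cong) (simp add: F.dual_add[OF f] fL)
    show "psum p m (\<lambda>i. f i v) \<le> ?s" if "norm v \<le> 1" for v
      by (rule F.psum_le_weak_psum[OF p f that])
  qed
  have lp0: "0 \<le> lp_norm p ?Q y" by (simp add: lp_norm_def)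
  have "(\<Sum>i<m. norm (f i (T (x i))) powr p) \<le> (\<Sum>i<m. \<Sum>n. norm (f i (w n)) powr p)"
    by (intro sum_mono entry) simp
  also have "\<dots> = (\<Sum>n. \<Sum>i<m. norm (f i (w n)) powr p)"
    using summable by (intro suminf_sum[symmetric]) simp
  also have "\<dots> \<le> (\<Sum>n. ?s powr p * nrm ?Q (y n) powr p)"
  proof (rule suminf_le)
    show "(\<Sum>i<m. norm (f i (w n)) powr p) \<le> ?s powr p * nrm ?Q (y n) powr p" for n
    proof -
      have "(\<Sum>i<m. norm (f i (w n)) powr p) \<le> (?s * nrm ?Q (y n)) powr p"
        using row[of n] p s0 y0 by (simp add: psum_le_iff)
      also have "\<dots> = ?s powr p * nrm ?Q (y n) powr p" using s0 y0 by (intro powr_mult)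
      finally show ?thesis .
    qed
    show "summable (\<lambda>n. \<Sum>i<m. norm (f i (w n)) powr p)" using summable by (intro summable_sum) simp
    show "summable (\<lambda>n. ?s powr p * nrm ?Q (y n) powr p)" by (intro summable_mult y_sum)
  qed
  also have "\<dots> = ?s powr p * (\<Sum>n. nrm ?Q (y n) powr p)" by (rule suminf_mult[OF y_sum])
  also have "\<dots> = ?s powr p * lp_norm p ?Q y powr p"
    using p y_sum by (simp add: lp_norm_def powr_powr suminf_nonneg)
  also have "\<dots> = (?s * lp_norm p ?Q y) powr p" using s0 lp0 by (intro powr_mult[symmetric])
  finally show ?thesis using p s0 lp0 by (simp add: psum_le_iff)
qed

text \<open>Neither the infimum in \<open>p_compact_norm\<close> nor the norms of the functionals
  composed with \<open>T\<close> need be attained. Hence the slack \<open>\<eta>\<close> and the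
  factor r < 1, each removed by a limit.\<close>

lemma p_summing_bound_if_max_hull_norm_le:
  assumes p: "1 \<le> p" and C: "0 \<le> C" and le: "max_hull_norm (p_compact_norm p) sE sF T \<le> ennreal C"
  shows "p_summing_bound p F.dual E.dual (adjoint_op (whole_nspace sE) (whole_nspace sF) T) C"
  unfolding p_summing_bound_adjoint_iff
proof (intro allI impI)
  fix m :: nat and f assume "\<forall>i<m. f i \<in> carrier F.dual"
  then have f: "f i \<in> carrier F.dual" if "i < m" for i using that by blast
  let ?s = "F.weak_psum p m f"
  have s0: "0 \<le> ?s" by (rule F.weak_psum_nonneg[OF p f])
  define L where "L = {y. \<forall>i<m. f i y = 0}"
  have Lc: "L \<in> closed_fin_codim_subspaces sF"
    unfolding L_def using f by (rule F.kernel_closed_fin_codim)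
  then have L: "F.subspace L" by (simp add: closed_fin_codim_subspaces_def)
  have point: "psum p m (\<lambda>i. f i (T (x i))) \<le> C * ?s" if x: "\<And>i. i < m \<Longrightarrow> norm (x i) \<le> 1" for x
  proof -
    define M where "M = E.span (x ` {..<m})"
    have M: "M \<in> fin_dim_subspaces sE" by (auto simp: fin_dim_subspaces_def M_def)
    have xM: "x i \<in> unit_ball (subspace_nspace sE M)" if "i < m" for i
      using x[OF that] that by (simp add: unit_ball_def M_def E.span_base)
    have "p_compact_norm p (subspace_nspace sE M) (quotient_nspace sF L) (\<lambda>x. coset L (T x)) \<le> ennreal C"
      by (rule order_trans[OF _ le[unfolded max_hull_norm_def]])
        (intro SUP_upper2[OF M] SUP_upper2[OF Lc] order_refl)
    then have small: "p_compact_norm p (subspace_nspace sE M) (quotient_nspace sF L)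
        (\<lambda>x. coset L (T x)) < ennreal (C + \<eta>)" if "\<eta> > 0" for \<eta>
      using C that by (auto intro: order.strict_trans1 ennreal_lessI)
    have step: "psum p m (\<lambda>i. f i (T (x i))) \<le> ?s * (C + \<eta>)" if \<eta>: "\<eta> > 0" for \<eta>
    proof -
      from small[OF \<eta>] obtain y where y: "y \<in> lp_space p (quotient_nspace sF L)"
          "(\<lambda>x. coset L (T x)) ` unit_ball (subspace_nspace sE M) \<subseteq> p_co p (quotient_nspace sF L) y"
          "ennreal (lp_norm p (quotient_nspace sF L) y) < ennreal (C + \<eta>)"
        unfolding p_compact_norm_def INF_less_iff by blast
      have "psum p m (\<lambda>i. f i (T (x i))) \<le> ?s * lp_norm p (quotient_nspace sF L) y"
        by (rule psum_le_if_p_compact[OF p f xM L _ y(1,2)]) (auto simp: L_def)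
      also have "\<dots> \<le> ?s * (C + \<eta>)"
        using y(3) s0 C \<eta> by (intro mult_left_mono) (auto simp: ennreal_less_iff lp_norm_def simp del: ennreal_plus)
      finally show ?thesis .
    qed
    have "psum p m (\<lambda>i. f i (T (x i))) \<le> ?s * C"
    proof (rule tendsto_lowerbound)
      show "((\<lambda>\<eta>. ?s * (C + \<eta>)) \<longlongrightarrow> ?s * C) (at_right 0)" by (auto intro!: tendsto_eq_intros)
      show "\<forall>\<^sub>F \<eta> in at_right 0. psum p m (\<lambda>i. f i (T (x i))) \<le> ?s * (C + \<eta>)"
        using eventually_at_right_less[of "0::real"] by eventually_elim (rule step)
    qed simp
    then show ?thesis by (simp add: mult.commute)
  qed
  define a where "a i = nrm E.dual (\<lambda>x. f i (T x))" for i
  have a0: "0 \<le> a i" if "i < m" for i unfolding a_def by (intro E.dual_nonneg comp_dual f that)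
  have "r * psum p m a \<le> C * ?s" if r: "0 < r" "r < 1" for r
  proof -
    \<comment> \<open>Without such a point, \<open>a i \<le> r * a i\<close> forces
      \<open>a i = 0\<close>, and then the origin is such a point after all.\<close>
    have "\<exists>x. norm x \<le> 1 \<and> r * a i \<le> norm (f i (T x))" if i: "i < m" for i
    proof (rule ccontr)
      assume no: "\<nexists>x. norm x \<le> 1 \<and> r * a i \<le> norm (f i (T x))"
      have "norm (f i (T x)) \<le> r * a i" if "norm x \<le> 1" for x
        using no that by (meson linear)
      then have "nrm E.dual (\<lambda>x. f i (T x)) \<le> r * a i" by (rule E.dual_nrm_le)
      then have "a i \<le> r * a i" by (simp only: a_def)
      moreover have "a i > 0 \<or> a i = 0" using a0[OF i] by linarith
      ultimately have "a i = 0" using r by auto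
      with no show False by (auto dest: spec[of _ 0])
    qed
    then obtain x where x: "\<And>i. i < m \<Longrightarrow> norm (x i) \<le> 1" "\<And>i. i < m \<Longrightarrow> r * a i \<le> norm (f i (T (x i)))"
      by metis
    have "r * psum p m a = psum p m (\<lambda>i. r * a i)" using psum_mult[OF p, of m r a] r by simp
    also have "\<dots> \<le> psum p m (\<lambda>i. f i (T (x i)))"
      using x(2) a0 r by (intro psum_mono[OF p]) (simp add: abs_mult)
    also have "\<dots> \<le> C * ?s" by (rule point[OF x(1)])
    finally show ?thesis .
  qed
  then have "psum p m a \<le> C * ?s" by (rule field_le_mult_one_interval)
  moreover have "a = (\<lambda>i. nrm E.dual (\<lambda>x. f i (T x)))" by (simp add: a_def fun_eq_iff)
  ultimately show "psum p m (\<lambda>i. nrm E.dual (\<lambda>x. f i (T x))) \<le> C * ?s" by simp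
qed

end


section \<open>Closed subspaces of finite codimension\<close>

context normed_space_over
begin

lemma mem_span_insert_subspace_iff:
  assumes "subspace L"
  shows "y \<in> span (insert b L) \<longleftrightarrow> (\<exists>c. y - scale c b \<in> L)"
  by (simp only: span_breakdown_eq span_eq_iff[THEN iffD2, OF assms])

text \<open>The radius of a ball around \<open>b\<close> that misses \<open>L\<close>, spread to all
  multiples of \<open>b\<close> by homogeneity. It makes the coefficient of \<open>b\<close> unique
  and continuous.\<close>

lemma closed_subspace_gap:
  assumes L: "subspace L" "closed L" and b: "b \<notin> L"
  obtains \<delta> where "\<delta> > 0" "\<And>c l. l \<in> L \<Longrightarrow> norm c * \<delta> \<le> norm (l + scale c b)"
proof -
  have "open (- L)" using L(2) by (simp add: open_Compl)
  with b obtain \<delta> where \<delta>: "\<delta> > 0" "ball b \<delta> \<subseteq> - L"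
    by (meson ComplI open_contains_ball)
  have gap: "\<delta> \<le> norm (l + b)" if "l \<in> L" for l
  proof (rule ccontr)
    assume "\<not> \<delta> \<le> norm (l + b)"
    then have "- l \<in> ball b \<delta>" by (simp add: dist_norm add.commute)
    then have "- l \<notin> L" using \<delta>(2) by blast
    then show False using subspace_neg[OF L(1) that] by simp
  qed
  have "norm c * \<delta> \<le> norm (l + scale c b)" if l: "l \<in> L" for c l
  proof (cases "c = 0")
    case False
    have "l + scale c b = scale c (scale (1 / c) l + b)"
      using False by (simp add: scale_right_distrib)
    then have "norm (l + scale c b) = norm c * norm (scale (1 / c) l + b)" by (simp add: norm_scale)
    then show ?thesis using gap[OF subspace_scale[OF L(1) l, of "1 / c"]] by (simp add: mult_left_mono)
  qed simp
  with \<delta>(1) show ?thesis using that by blast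
qed

text \<open>By the gap estimate, the coefficients of \<open>b\<close> along a convergent sequence
  are Cauchy. They converge in the scalars, and what remains converges in \<open>L\<close>.\<close>

lemma closed_span_insert:
  assumes L: "subspace L" "closed L" and b: "b \<notin> L"
  shows "closed (span (insert b L))"
proof -
  note mem = mem_span_insert_subspace_iff[OF L(1)]
  obtain \<delta> where \<delta>: "\<delta> > 0" "\<And>c l. l \<in> L \<Longrightarrow> norm c * \<delta> \<le> norm (l + scale c b)"
    using closed_subspace_gap[OF L b] by blast
  show ?thesis
    unfolding closed_sequential_limits
  proof (intro allI impI, elim conjE)
    fix y z assume "\<forall>n. y n \<in> span (insert b L)" and lim: "y \<longlonglongrightarrow> z"
    then obtain c where c: "\<And>n. y n - scale (c n) b \<in> L" unfolding mem by metis
    have c_le: "norm (c m - c n) \<le> norm (y m - y n) / \<delta>" for m n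
    proof -
      have "(y m - scale (c m) b) - (y n - scale (c n) b) \<in> L" by (rule subspace_diff[OF L(1) c c])
      from \<delta>(2)[OF this, of "c m - c n"] \<delta>(1) show ?thesis
        by (simp add: scale_left_diff_distrib pos_le_divide_eq)
    qed
    have "Cauchy c"
    proof (rule metric_CauchyI)
      fix e :: real assume "e > 0"
      then have "e * \<delta> > 0" using \<delta>(1) by simp
      then obtain M where "\<And>m n. m \<ge> M \<Longrightarrow> n \<ge> M \<Longrightarrow> dist (y m) (y n) < e * \<delta>"
        using metric_CauchyD[OF LIMSEQ_imp_Cauchy[OF lim]] by blast
      then have "norm (y m - y n) / \<delta> < e" if "m \<ge> M" "n \<ge> M" for m n
        using that \<delta>(1) by (simp add: dist_norm pos_divide_less_eq)
      then have "\<forall>m\<ge>M. \<forall>n\<ge>M. dist (c m) (c n) < e"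
        unfolding dist_norm using c_le order.strict_trans1 by blast
      then show "\<exists>M. \<forall>m\<ge>M. \<forall>n\<ge>M. dist (c m) (c n) < e" by blast
    qed
    then obtain a where a: "c \<longlonglongrightarrow> a" using Cauchy_convergent convergent_def by blast
    have "(\<lambda>n. norm (c n - a) * norm b) \<longlonglongrightarrow> 0"
      using a by (intro tendsto_mult_left_zero) (simp add: LIM_zero_iff tendsto_norm_zero_iff)
    then have "(\<lambda>n. scale (c n) b - scale a b) \<longlonglongrightarrow> 0"
      by (intro Lim_null_comparison[OF _ \<open>(\<lambda>n. norm (c n - a) * norm b) \<longlonglongrightarrow> 0\<close>])
        (simp add: norm_scale flip: scale_left_diff_distrib)
    then have "(\<lambda>n. scale (c n) b) \<longlonglongrightarrow> scale a b" by (simp add: LIM_zero_iff)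
    then have "(\<lambda>n. y n - scale (c n) b) \<longlonglongrightarrow> z - scale a b" by (intro tendsto_diff lim)
    then have "z - scale a b \<in> L" by (rule closed_sequentially[OF L(2) c])
    then show "z \<in> span (insert b L)" unfolding mem by blast
  qed
qed

text \<open>Coordinates modulo \<open>L\<close>, built by adjoining one vector at a time to \<open>L\<close>.\<close>

lemma fin_codim_coordinates:
  assumes "finite B" "subspace L" "closed L" "span (L \<union> B) = UNIV"
  shows "\<exists>d e b. (\<forall>k<d::nat. e k \<in> carrier dual \<and> (\<forall>l\<in>L. e k l = 0)) \<and>
    (\<forall>y. y - (\<Sum>k<d. scale (e k y) (b k)) \<in> L)"
  using assms
proof (induction B arbitrary: L rule: finite_induct)
  case empty
  then have "L = UNIV" using span_eq_iff[of L] by simp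
  then show ?case by (intro exI[of _ 0]) simp
next
  case (insert a B)
  show ?case
  proof (cases "a \<in> L")
    case True
    then have "L \<union> insert a B = L \<union> B" by blast
    with insert show ?thesis by simp
  next
    case False
    define L' where "L' = span (insert a L)"
    have LL': "L \<subseteq> L'" by (auto simp: L'_def intro: span_base)
    have "span (L' \<union> B) = UNIV"
    proof -
      have "L \<union> insert a B \<subseteq> L' \<union> B" using LL' by (auto simp: L'_def intro: span_base)
      then show ?thesis using insert.prems(3) span_mono by blast
    qed
    moreover have "closed L'" unfolding L'_def by (rule closed_span_insert[OF insert.prems(1,2) False])
    moreover have "subspace L'" by (simp add: L'_def)
    ultimately obtain d :: nat and e b where
        e: "\<And>k. k < d \<Longrightarrow> e k \<in> carrier dual" "\<And>k l. k < d \<Longrightarrow> l \<in> L' \<Longrightarrow> e k l = 0"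
        and b: "\<And>y. y - (\<Sum>k<d. scale (e k y) (b k)) \<in> L'"
      using insert.IH[of L'] by metis
    \<comment> \<open>Removing the coordinates modulo \<open>L'\<close> leaves a vector of
      \<open>L'\<close>; its coefficient along \<open>a\<close> is the new coordinate.\<close>
    define \<pi> where "\<pi> y = y - (\<Sum>k<d. scale (e k y) (b k))" for y
    have "\<exists>c. \<pi> y - scale c a \<in> L" for y
      using b[of y] unfolding \<pi>_def L'_def mem_span_insert_subspace_iff[OF insert.prems(1)] .
    then obtain g where g: "\<And>y. \<pi> y - scale (g y) a \<in> L" by metis
    obtain \<delta> where \<delta>: "\<delta> > 0" "\<And>c l. l \<in> L \<Longrightarrow> norm c * \<delta> \<le> norm (l + scale c a)"
      using closed_subspace_gap[OF insert.prems(1,2) False] by blast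
    \<comment> \<open>Uniqueness of the coefficient makes the choice \<open>g\<close> linear and
      zero on \<open>L\<close>.\<close>
    have unique: "g y = c" if "\<pi> y - scale c a \<in> L" for y c
    proof -
      have "(\<pi> y - scale c a) - (\<pi> y - scale (g y) a) \<in> L"
        by (rule subspace_diff[OF insert.prems(1) that g])
      from \<delta>(2)[OF this, of "c - g y"] \<delta>(1) show ?thesis
        by (simp add: scale_left_diff_distrib mult_le_0_iff)
    qed
    have \<pi>_add: "\<pi> (x + y) = \<pi> x + \<pi> y" for x y
      by (simp add: \<pi>_def dual_add[OF e(1)] scale_left_distrib sum.distrib)
    have \<pi>_scale: "\<pi> (scale c y) = scale c (\<pi> y)" for c y
      by (simp add: \<pi>_def dual_scale[OF e(1)] scale_right_diff_distrib scale_sum_right)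
    have \<pi>_le: "norm (\<pi> y) \<le> (1 + (\<Sum>k<d. nrm dual (e k) * norm (b k))) * norm y" for y
    proof -
      have "norm (\<pi> y) \<le> norm y + norm (\<Sum>k<d. scale (e k y) (b k))"
        unfolding \<pi>_def by (rule norm_triangle_ineq4)
      also have "norm (\<Sum>k<d. scale (e k y) (b k)) \<le> (\<Sum>k<d. nrm dual (e k) * norm (b k) * norm y)"
      proof (rule sum_norm_le)
        fix k assume "k \<in> {..<d}"
        then show "norm (scale (e k y) (b k)) \<le> nrm dual (e k) * norm (b k) * norm y"
          using mult_right_mono[OF dual_le[OF e(1), of k y], of "norm (b k)"]
          by (simp add: norm_scale ac_simps)
      qed
      finally show ?thesis by (simp add: distrib_right sum_distrib_right)
    qed
    have "g \<in> carrier dual"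
      unfolding dual_iff
    proof (intro conjI allI exI)
      show "g (x + y) = g x + g y" for x y
        using subspace_add[OF insert.prems(1) g[of x] g[of y]]
        by (intro unique) (simp add: \<pi>_add scale_left_distrib algebra_simps)
      show "g (scale c y) = c * g y" for c y
        using subspace_scale[OF insert.prems(1) g[of y], of c]
        by (intro unique) (simp add: \<pi>_scale scale_right_diff_distrib)
      show "norm (g y) \<le> ((1 + (\<Sum>k<d. nrm dual (e k) * norm (b k))) / \<delta>) * norm y" for y
      proof -
        have "norm (g y) * \<delta> \<le> norm (\<pi> y)" using \<delta>(2)[OF g, of "g y" y] by simp
        with \<pi>_le[of y] \<delta>(1) show ?thesis by (simp add: pos_le_divide_eq)
      qed
    qed
    moreover have "g l = 0" if "l \<in> L" for l
      using that LL' e(2) by (intro unique) (auto simp: \<pi>_def)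
    moreover have "y - (\<Sum>k<Suc d. scale ((e(d := g)) k y) ((b(d := a)) k)) \<in> L" for y
    proof -
      have "(\<Sum>k<d. scale ((e(d := g)) k y) ((b(d := a)) k)) = (\<Sum>k<d. scale (e k y) (b k))"
        by (intro sum.cong) auto
      with g[of y] show ?thesis by (simp add: \<pi>_def algebra_simps)
    qed
    ultimately show ?thesis
      using e LL' by (intro exI[of _ "Suc d"] exI[of _ "e(d := g)"] exI[of _ "b(d := a)"])
        (auto simp: less_Suc_eq)
  qed
qed

text \<open>On the unit ball the coordinates range over compact discs of scalars, so total
  boundedness is needed only there. The conclusion speaks of a short vector \<open>r\<close> instead
  of a quotient norm, so that functionals vanishing on \<open>L\<close> can be evaluated at
  it.\<close>

lemma finite_net_mod_subspace:
  fixes d :: nat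
  assumes e: "\<And>k. k < d \<Longrightarrow> e k \<in> carrier dual"
    and b: "\<And>y. y - (\<Sum>k<d. scale (e k y) (b k)) \<in> L" and \<delta>: "\<delta> > 0"
  obtains N :: nat and ys where "N > 0" "\<And>j. j < N \<Longrightarrow> norm (ys j) \<le> 1"
    "\<And>y. norm y \<le> 1 \<Longrightarrow> \<exists>j<N. \<exists>r. y - ys j - r \<in> L \<and> norm r \<le> \<delta>"
proof -
  \<comment> \<open>Coordinates that agree up to \<open>\<delta> / D\<close> give a difference of
    norm at most \<open>\<delta>\<close> modulo \<open>L\<close>; the summand 1 keeps
    \<open>D\<close> positive.\<close>
  define D where "D = 1 + (\<Sum>k<d. norm (b k))"
  have D: "D > 0" by (simp add: D_def sum_nonneg add_pos_nonneg)
  define \<epsilon> where "\<epsilon> = \<delta> / D"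
  have \<epsilon>: "\<epsilon> > 0" using \<delta> D by (simp add: \<epsilon>_def)
  have ex: "\<exists>C. finite C \<and> cball (0::'k) (nrm dual (e k)) \<subseteq> (\<Union>t\<in>C. ball t (\<epsilon> / 2))" for k
  proof -
    have "0 < \<epsilon> / 2" using \<epsilon> by simp
    then have "\<exists>C. finite C \<and> C \<subseteq> cball (0::'k) (nrm dual (e k)) \<and>
        cball 0 (nrm dual (e k)) \<subseteq> (\<Union>t\<in>C. ball t (\<epsilon> / 2))"
      by (intro seq_compact_imp_totally_bounded[rule_format])
        (simp_all add: compact_imp_seq_compact[OF compact_cball])
    then show ?thesis by blast
  qed
  have "\<exists>C. \<forall>k. finite (C k) \<and> cball (0::'k) (nrm dual (e k)) \<subseteq> (\<Union>t\<in>C k. ball t (\<epsilon> / 2))"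
    by (intro choice allI ex)
  then obtain C where C: "\<And>k. finite (C k)" "\<And>k. cball (0::'k) (nrm dual (e k)) \<subseteq> (\<Union>t\<in>C k. ball t (\<epsilon> / 2))"
    by blast
  define t where "t k y = (SOME s. s \<in> C k \<and> dist s (e k y) < \<epsilon> / 2)" for k y
  have t: "t k y \<in> C k \<and> dist (t k y) (e k y) < \<epsilon> / 2" if "k < d" "norm y \<le> 1" for k y
  proof -
    have "norm (e k y) \<le> nrm dual (e k)"
      using dual_le[OF e[OF that(1)], of y] mult_left_mono[OF that(2) dual_nonneg[OF e[OF that(1)]]]
      by simp
    then have "e k y \<in> cball 0 (nrm dual (e k))" by simp
    with C(2)[of k] have "e k y \<in> (\<Union>t\<in>C k. ball t (\<epsilon> / 2))" by (rule subsetD)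
    then have "\<exists>s. s \<in> C k \<and> dist s (e k y) < \<epsilon> / 2" by auto
    then show ?thesis unfolding t_def by (rule someI_ex)
  qed
  define \<kappa> where "\<kappa> y = (\<lambda>k\<in>{..<d}. t k y)" for y
  have "\<kappa> ` cball 0 1 \<subseteq> PiE {..<d} C"
    unfolding \<kappa>_def using t by (intro image_subsetI) (simp only: restrict_PiE_iff, simp)
  then have "finite (\<kappa> ` cball 0 1)"
    by (rule finite_subset) (intro finite_PiE, auto simp: C)
  \<comment> \<open>There are finitely many codes \<open>\<kappa> y\<close>; one point of the ball
    for each code forms the net.\<close>
  then obtain S where S: "S \<subseteq> cball 0 1" "finite S" "\<kappa> ` cball 0 1 = \<kappa> ` S"
    using finite_subset_image[of "\<kappa> ` cball 0 1" \<kappa> "cball 0 1"] by blast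
  obtain ys where ys: "bij_betw ys {0..<card S} S" using ex_bij_betw_nat_finite[OF S(2)] by blast
  have "S \<noteq> {}" using S(3) by auto
  then have "card S > 0" using S(2) by (simp add: card_gt_0_iff)
  moreover have "norm (ys j) \<le> 1" if "j < card S" for j
    using bij_betwE[OF ys] that S(1) by (auto simp: subset_iff)
  moreover have "\<exists>j<card S. \<exists>r. y - ys j - r \<in> L \<and> norm r \<le> \<delta>" if y: "norm y \<le> 1" for y
  proof -
    have "\<kappa> y \<in> \<kappa> ` S" using y S(3) by auto
    then obtain z where z: "z \<in> S" "\<kappa> z = \<kappa> y" by auto
    then have "z \<in> ys ` {0..<card S}" by (simp only: bij_betw_imp_surj_on[OF ys])
    then obtain j where j: "j < card S" "ys j = z" by auto
    have z1: "norm z \<le> 1" using z(1) S(1) by auto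
    have close: "norm (e k (y - z)) \<le> \<epsilon>" if k: "k < d" for k
    proof -
      have "t k z = t k y" using fun_cong[OF z(2), of k] k by (simp add: \<kappa>_def)
      then have "dist (e k y) (e k z) < \<epsilon>"
        using t[OF k y] t[OF k z1] dist_triangle3[of "e k y" "e k z" "t k y"] by simp
      then show ?thesis by (simp add: dist_norm dual_diff[OF e[OF k]])
    qed
    define r where "r = (\<Sum>k<d. scale (e k (y - z)) (b k))"
    have "norm r \<le> (\<Sum>k<d. \<epsilon> * norm (b k))"
      unfolding r_def using close by (intro sum_norm_le) (simp add: norm_scale mult_right_mono)
    also have "\<dots> \<le> \<epsilon> * D" using \<epsilon> by (simp add: D_def flip: sum_distrib_left)
    also have "\<dots> = \<delta>" using D by (simp add: \<epsilon>_def)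
    finally have "norm r \<le> \<delta>" .
    moreover have "y - z - r \<in> L" unfolding r_def by (rule b)
    ultimately show ?thesis using j by blast
  qed
  ultimately show ?thesis using that by blast
qed

end


section \<open>From summing adjoints to compact quotients\<close>

context bounded_operator
begin

text \<open>Pietsch's domination theorem for the adjoint on the annihilator of \<open>L\<close>: a finite net of the
  unit ball modulo \<open>L\<close> replaces the compact ball, so the dominating measure is a finite weight.\<close>

lemma adjoint_dominated:
  assumes p: "1 \<le> p" and C: "0 \<le> C" "C < C'" and L: "L \<in> closed_fin_codim_subspaces sF"
    and bound: "p_summing_bound p F.dual E.dual (adjoint_op (whole_nspace sE) (whole_nspace sF) T) C"
  obtains N z where "(\<Sum>j<N::nat. norm (z j) powr p) \<le> C' powr p"
    "\<And>f. f \<in> carrier F.dual \<Longrightarrow> (\<forall>l\<in>L. f l = 0) \<Longrightarrow>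
      nrm E.dual (\<lambda>x. f (T x)) \<le> psum p N (\<lambda>j. f (z j))"
proof -
  have L': "F.subspace L" using L by (simp add: closed_fin_codim_subspaces_def)
  obtain B where "finite B" "closed L" "F.span (L \<union> B) = UNIV"
    using L by (auto simp: closed_fin_codim_subspaces_def)
  then obtain d :: nat and e b where
      e: "\<And>k. k < d \<Longrightarrow> e k \<in> carrier F.dual" and b: "\<And>y. y - (\<Sum>k<d. sF (e k y) (b k)) \<in> L"
    using F.fin_codim_coordinates[OF _ L', of B] by metis
  \<comment> \<open>Half of the relative gap between \<open>C\<close> and \<open>C'\<close>: the
    loss \<open>1 - \<delta>\<close> caused by the net still leaves
    \<open>C \<le> C' * (1 - \<delta>)\<close>.\<close>
  define \<delta> where "\<delta> = (1 - C / C') / 2"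
  have C': "C' > 0" using C by simp
  then have "C / C' < 1" using C by simp
  then have \<delta>: "0 < \<delta>" "\<delta> < 1" "C / C' \<le> 1 - \<delta>"
    using C C' by (auto simp: \<delta>_def field_simps)
  then have CC': "C \<le> C' * (1 - \<delta>)" using C' by (simp add: field_simps)
  obtain N :: nat and ys where N: "N > 0" and ys: "\<And>j. j < N \<Longrightarrow> norm (ys j) \<le> 1"
      and net: "\<And>y. norm y \<le> 1 \<Longrightarrow> \<exists>j<N. \<exists>r. y - ys j - r \<in> L \<and> norm r \<le> \<delta>"
    by (rule F.finite_net_mod_subspace[OF e b \<delta>(1)]) auto
  define A where "A = {f \<in> carrier F.dual. \<forall>l\<in>L. f l = 0}"
  have A: "f \<in> carrier F.dual" "\<And>l. l \<in> L \<Longrightarrow> f l = 0" if "f \<in> A" for f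
    using that by (auto simp: A_def)
  define a where "a f = nrm E.dual (\<lambda>x. f (T x))" for f
  have a0: "0 \<le> a f" if "f \<in> A" for f
    unfolding a_def by (intro E.dual_nonneg comp_dual A that)
  have family: "\<exists>j<N. (\<Sum>i<m. a (f i) powr p) \<le> C' powr p * (\<Sum>i<m. norm (f i (ys j)) powr p)"
    if f: "\<And>i. i < m \<Longrightarrow> f i \<in> A" for m :: nat and f
  proof -
    let ?s = "F.weak_psum p m f"
    have fA: "f i \<in> carrier F.dual" if "i < m" for i by (rule A(1)[OF f[OF that]])
    have s0: "0 \<le> ?s" by (rule F.weak_psum_nonneg[OF p fA])
    have small: "psum p m (\<lambda>i. f i r) \<le> \<delta> * ?s" if r: "norm r \<le> \<delta>" for r
    proof -
      have "psum p m (\<lambda>i. f i r) = psum p m (\<lambda>i. of_real \<delta> * f i ((1 / \<delta>) *\<^sub>R r))"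
        using \<delta>(1) by (intro psum_cong) (simp add: F.dual_scaleR[OF fA])
      also have "\<dots> = \<delta> * psum p m (\<lambda>i. f i ((1 / \<delta>) *\<^sub>R r))"
        using \<delta>(1) psum_mult[OF p, of m "of_real \<delta>" "\<lambda>i. f i ((1 / \<delta>) *\<^sub>R r)"] by simp
      also have "\<dots> \<le> \<delta> * ?s"
        using \<delta>(1) r by (intro mult_left_mono F.psum_le_weak_psum[OF p fA]) (auto simp: field_simps)
      finally show ?thesis .
    qed
    define q where "q = Max ((\<lambda>j. psum p m (\<lambda>i. f i (ys j))) ` {..<N})"
    have ne: "(\<lambda>j. psum p m (\<lambda>i. f i (ys j))) ` {..<N} \<noteq> {}" using N by auto
    \<comment> \<open>The net error is a multiple of the weak p-norm itself, so it can be absorbed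
      into the left-hand side.\<close>
    have "?s \<le> q + \<delta> * ?s"
    proof (rule F.weak_psum_le[OF p fA])
      fix y :: 'b assume "norm y \<le> 1"
      then obtain j r where jr: "j < N" "y - ys j - r \<in> L" "norm r \<le> \<delta>" using net by blast
      have "f i y = f i (ys j) + f i r" if "i < m" for i
      proof -
        have "f i y - f i (ys j) - f i r = 0"
          using A(2)[OF f[OF that] jr(2)] by (simp add: F.dual_diff[OF fA[OF that]])
        then show ?thesis by (simp add: algebra_simps)
      qed
      then have "psum p m (\<lambda>i. f i y) = psum p m (\<lambda>i. f i (ys j) + f i r)"
        by (intro psum_cong) simp
      also have "\<dots> \<le> psum p m (\<lambda>i. f i (ys j)) + psum p m (\<lambda>i. f i r)" by (rule psum_triangle[OF p])
      also have "\<dots> \<le> q + \<delta> * ?s"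
        using jr by (intro add_mono small) (auto simp: q_def)
      finally show "psum p m (\<lambda>i. f i y) \<le> q + \<delta> * ?s" .
    qed
    then have sq: "(1 - \<delta>) * ?s \<le> q" by (simp add: algebra_simps)
    have "q \<in> (\<lambda>j. psum p m (\<lambda>i. f i (ys j))) ` {..<N}"
      unfolding q_def by (rule Max_in) (use ne in auto)
    then obtain j where j: "j < N" "q = psum p m (\<lambda>i. f i (ys j))" by auto
    have "psum p m (\<lambda>i. a (f i)) \<le> C * ?s"
      using bound fA unfolding p_summing_bound_adjoint_iff a_def by blast
    also have "\<dots> \<le> (C' * (1 - \<delta>)) * ?s" by (rule mult_right_mono[OF CC' s0])
    also have "\<dots> \<le> C' * q" using sq C' by (simp add: mult.assoc)
    finally have le: "psum p m (\<lambda>i. a (f i)) \<le> C' * q" .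
    have "(\<Sum>i<m. norm (a (f i)) powr p) \<le> (C' * q) powr p"
      using le p C' psum_nonneg[of p m "\<lambda>i. f i (ys j)"] by (simp add: psum_le_iff j(2) del: real_norm_def)
    also have "\<dots> = C' powr p * q powr p"
      using C' psum_nonneg[of p m "\<lambda>i. f i (ys j)"] by (simp add: powr_mult j(2))
    also have "q powr p = (\<Sum>i<m. norm (f i (ys j)) powr p)" unfolding j(2) by (rule psum_powr[OF p])
    finally have "(\<Sum>i<m. norm (a (f i)) powr p) \<le> C' powr p * (\<Sum>i<m. norm (f i (ys j)) powr p)" .
    moreover have "(\<Sum>i<m. norm (a (f i)) powr p) = (\<Sum>i<m. a (f i) powr p)"
      using a0 f by (intro sum.cong) auto
    ultimately show ?thesis using j(1) by auto
  qed
  \<comment> \<open>The desired domination is that one weighted sum of \<open>v f j\<close> over j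
    is nonnegative for all \<open>f\<close> at once. \<open>family\<close> only gives, for each
    finite family, one net point where the summed \<open>v\<close> is nonnegative; minimax exchanges
    the quantifiers.\<close>
  define v where "v f j = C' powr p * norm (f (ys j)) powr p - a f powr p" for f j
  \<comment> \<open>Lists allow repetitions, so addition is concatenation.\<close>
  define Cn where "Cn = {(\<lambda>j. \<Sum>f\<leftarrow>fs. v f j) |fs. set fs \<subseteq> A}"
  have Cn_cone: "convex_cone Cn"
    unfolding convex_cone_iff
  proof (intro conjI ballI allI impI)
    show "0 \<in> Cn" unfolding Cn_def by (auto intro!: exI[of _ "[]"])
  next
    fix g h assume "g \<in> Cn" "h \<in> Cn"
    then obtain fs gs where "g = (\<lambda>j. \<Sum>f\<leftarrow>fs. v f j)" "h = (\<lambda>j. \<Sum>f\<leftarrow>gs. v f j)" "set fs \<subseteq> A" "set gs \<subseteq> A"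
      by (auto simp: Cn_def)
    then show "g + h \<in> Cn" unfolding Cn_def by (auto intro!: exI[of _ "fs @ gs"])
  next
    fix g and t :: real assume "g \<in> Cn" and t: "0 \<le> t"
    then obtain fs where fs: "g = (\<lambda>j. \<Sum>f\<leftarrow>fs. v f j)" "set fs \<subseteq> A" by (auto simp: Cn_def)
    \<comment> \<open>\<open>v\<close> is homogeneous of degree \<open>p\<close> in
      \<open>f\<close>, so a nonnegative factor is absorbed into the functionals and the cone needs
      no coefficients.\<close>
    define c where "c = t powr (1 / p)"
    have c: "0 \<le> c" "c powr p = t" using p t by (auto simp: c_def powr_powr)
    define h :: "('b \<Rightarrow> 'k) \<Rightarrow> 'b \<Rightarrow> 'k" where "h f = (\<lambda>x. of_real c * f x)" for f
    have "h f \<in> A \<and> (\<forall>j. v (h f) j = t * v f j)" if f: "f \<in> A" for f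
    proof -
      have "a (h f) = c * a f"
        using c(1) homogeneous_nspaceD(3)[OF E.homogeneous_dual comp_dual[OF A(1)[OF f]], of "of_real c"]
        by (simp add: a_def h_def dual_nspace_simps(4) restrict_UNIV)
      then show ?thesis
        using f F.dual_cmult[of f "of_real c"] c a0[OF f]
        by (auto simp: A_def h_def v_def norm_mult powr_mult algebra_simps)
    qed
    then have "t *\<^sub>R g = (\<lambda>j. \<Sum>f\<leftarrow>map h fs. v f j)" "set (map h fs) \<subseteq> A"
      using fs by (auto simp: fun_eq_iff o_def subset_iff simp flip: sum_list_const_mult
          intro!: arg_cong[where f = sum_list] map_cong)
    then show "t *\<^sub>R g \<in> Cn" unfolding Cn_def by blast
  qed
  have "\<exists>j<N. 0 \<le> g j" if "g \<in> Cn" for g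
  proof -
    from that obtain fs where fs: "g = (\<lambda>j. \<Sum>f\<leftarrow>fs. v f j)" "set fs \<subseteq> A" by (auto simp: Cn_def)
    have g: "g j = (\<Sum>i<length fs. v (fs ! i) j)" for j
      by (simp add: fs(1) sum_list_sum_nth atLeast0LessThan)
    have "\<exists>j<N. (\<Sum>i<length fs. a (fs ! i) powr p) \<le> C' powr p * (\<Sum>i<length fs. norm ((fs ! i) (ys j)) powr p)"
      using fs(2) by (intro family) auto
    then show ?thesis by (auto simp: g v_def sum_subtractf sum_distrib_left)
  qed
  then obtain w where w: "\<And>j. j < N \<Longrightarrow> 0 \<le> w j" "(\<Sum>j<N. w j) = 1"
      "\<And>g. g \<in> Cn \<Longrightarrow> 0 \<le> (\<Sum>j<N. g j * w j)"
    using finite_minimax[OF N Cn_cone] by blast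
  \<comment> \<open>Weight and constant move into the vectors. The next fact is applied both to the
    identity and to functionals.\<close>
  define z where "z j = (C' * w j powr (1 / p)) *\<^sub>R ys j" for j
  have norm_z: "norm (g (z j)) powr p = C' powr p * norm (g (ys j)) powr p * w j"
    if "j < N" "\<And>r x. norm (g (r *\<^sub>R x)) = \<bar>r\<bar> * norm (g x)" for j and g :: "'b \<Rightarrow> 'c::real_normed_vector"
    using that w(1)[OF that(1)] C' p by (simp add: z_def powr_mult powr_powr abs_mult)
  show ?thesis
  proof (rule that)
    have "norm (z j) powr p \<le> C' powr p * w j" if j: "j < N" for j
    proof -
      have "norm (ys j) powr p \<le> 1" using ys[OF j] p by (simp add: powr_le1)
      then have "C' powr p * norm (ys j) powr p * w j \<le> C' powr p * 1 * w j"
        using w(1)[OF j] by (intro mult_left_mono mult_right_mono) auto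
      then show ?thesis using norm_z[of j "\<lambda>x. x"] j by simp
    qed
    then have "(\<Sum>j<N. norm (z j) powr p) \<le> (\<Sum>j<N. C' powr p * w j)" by (intro sum_mono) simp
    then show "(\<Sum>j<N. norm (z j) powr p) \<le> C' powr p"
      using w(2) by (simp flip: sum_distrib_left)
  next
    fix f assume "f \<in> carrier F.dual" "\<forall>l\<in>L. f l = 0"
    then have f: "f \<in> A" by (simp add: A_def)
    have "v f \<in> Cn" unfolding Cn_def using f by (intro CollectI exI[of _ "[f]"]) simp
    from w(3)[OF this] have "a f powr p * (\<Sum>j<N. w j) \<le> (\<Sum>j<N. C' powr p * norm (f (ys j)) powr p * w j)"
      by (simp add: v_def left_diff_distrib sum_subtractf sum_distrib_left)
    also have "\<dots> = (\<Sum>j<N. norm (f (z j)) powr p)"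
      by (intro sum.cong norm_z[symmetric]) (auto simp: F.dual_scaleR[OF A(1)[OF f]] norm_mult)
    \<comment> \<open>One number is written as a p-sum of length 1, so that
      \<open>psum_le_iff\<close> takes the root.\<close>
    finally have "(\<Sum>i<1::nat. norm (a f) powr p) \<le> psum p N (\<lambda>j. f (z j)) powr p"
      using a0[OF f] by (simp add: w(2) psum_powr[OF p])
    then have "psum p 1 (\<lambda>_. a f) \<le> psum p N (\<lambda>j. f (z j))"
      by (simp only: psum_le_iff[OF p psum_nonneg])
    then show "nrm E.dual (\<lambda>x. f (T x)) \<le> psum p N (\<lambda>j. f (z j))"
      using p a0[OF f] by (simp add: psum_def a_def powr_powr)
  qed
qed

text \<open>The functional to be extended enters as its graph, a cone pairing
  \<open>(f (z j))\<close> with the real part of \<open>f u\<close>. Domination alone is checked;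
  that the values are well defined on the tuples is a consequence and no separate step.\<close>

lemma mem_p_co_if_dominated:
  assumes p: "1 \<le> p" and L: "L \<in> closed_fin_codim_subspaces sF"
    and dom: "\<And>f. f \<in> carrier F.dual \<Longrightarrow> (\<forall>l\<in>L. f l = 0) \<Longrightarrow> norm (f u) \<le> psum p N (\<lambda>j. f (z j))"
  shows "coset L u \<in> p_co p (quotient_nspace sF L) (\<lambda>n. coset L (if n < N then z n else 0))"
proof -
  have L': "F.subspace L" using L by (simp add: closed_fin_codim_subspaces_def)
  obtain B where "finite B" "closed L" "F.span (L \<union> B) = UNIV"
    using L by (auto simp: closed_fin_codim_subspaces_def)
  then obtain d :: nat and e b where
      e: "\<And>k. k < d \<Longrightarrow> e k \<in> carrier F.dual" "\<And>k l. k < d \<Longrightarrow> l \<in> L \<Longrightarrow> e k l = 0"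
      and b: "\<And>y. y - (\<Sum>k<d. sF (e k y) (b k)) \<in> L"
    using F.fin_codim_coordinates[OF _ L', of B] by metis
  define A where "A = {f \<in> carrier F.dual. \<forall>l\<in>L. f l = 0}"
  have A: "f \<in> carrier F.dual" "\<And>l. l \<in> L \<Longrightarrow> f l = 0" if "f \<in> A" for f
    using that by (auto simp: A_def)
  have A_cmult: "(\<lambda>x. c * f x) \<in> A" if "f \<in> A" for c f
    using that F.dual_cmult by (auto simp: A_def)
  define Cn where "Cn = (\<lambda>f. ((\<lambda>j. f (z j)), f u \<bullet> 1)) ` A"
  have cone: "convex_cone Cn"
    unfolding convex_cone_iff
  proof (intro conjI ballI allI impI)
    have "(\<lambda>x. 0) \<in> A" using F.dual_zero by (simp add: A_def)
    then show "0 \<in> Cn" unfolding Cn_def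
      by (rule rev_image_eqI) (simp add: zero_prod_def zero_fun_def)
  next
    fix g h assume "g \<in> Cn" "h \<in> Cn"
    then obtain f f' where "f \<in> A" "f' \<in> A"
      and gh: "g = ((\<lambda>j. f (z j)), f u \<bullet> 1)" "h = ((\<lambda>j. f' (z j)), f' u \<bullet> 1)"
      by (auto simp: Cn_def)
    then have "(\<lambda>x. f x + f' x) \<in> A" using F.dual_plus by (auto simp: A_def)
    then show "g + h \<in> Cn" unfolding Cn_def
      by (rule rev_image_eqI) (simp add: gh plus_fun_def inner_add_left)
  next
    fix g and t :: real assume "g \<in> Cn" "0 \<le> t"
    then obtain f where f: "f \<in> A" and g: "g = ((\<lambda>j. f (z j)), f u \<bullet> 1)"
      by (auto simp: Cn_def)
    show "t *\<^sub>R g \<in> Cn" unfolding Cn_def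
      by (rule rev_image_eqI[OF A_cmult[OF f, of "of_real t"]])
        (simp add: g scaleR_fun_def flip: scaleR_conv_of_real)
  qed
  have "r \<le> psum p N v" if "(v, r) \<in> Cn" for v r
  proof -
    from that obtain f where f: "f \<in> A" "v = (\<lambda>j. f (z j))" "r = f u \<bullet> 1" by (auto simp: Cn_def)
    have "f u \<bullet> 1 \<le> norm (f u)" by (rule inner_one_le_norm)
    also have "\<dots> \<le> psum p N (\<lambda>j. f (z j))" using A[OF f(1)] by (intro dom) auto
    finally show ?thesis by (simp add: f)
  qed
  then obtain \<beta> where \<beta>: "\<And>x. norm (\<Sum>j<N. x j * \<beta> j) \<le> psum p N x"
      and \<beta>A: "\<And>v r. (v, r) \<in> Cn \<Longrightarrow> r \<le> (\<Sum>j<N. v j * \<beta> j) \<bullet> 1"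
    using mazur_orlicz_psum[OF p cone] by blast
  define g where "g = (\<Sum>j<N. sF (\<beta> j) (z j)) - u"
  have fg: "f g = 0" if f: "f \<in> A" for f
  proof (rule eq_0_if_inner_one_nonneg)
    fix c
    \<comment> \<open>The cone contains all scalar multiples, so the lower bound of Mazur-Orlicz
      becomes equality: \<open>f\<close> agrees at \<open>u\<close> and at the combination of the
      \<open>z j\<close>.\<close>
    have "((\<lambda>j. c * f (z j)), (c * f u) \<bullet> 1) \<in> Cn"
      unfolding Cn_def by (rule rev_image_eqI[OF A_cmult[OF f, of c]]) simp
    from \<beta>A[OF this] have "0 \<le> ((\<Sum>j<N. c * f (z j) * \<beta> j) - c * f u) \<bullet> 1"
      by (simp add: inner_diff_left)
    also have "(\<Sum>j<N. c * f (z j) * \<beta> j) - c * f u = c * f g"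
      by (simp add: g_def F.dual_diff[OF A(1)[OF f]] F.dual_sum[OF A(1)[OF f]] F.dual_scale[OF A(1)[OF f]]
          right_diff_distrib sum_distrib_left ac_simps)
    finally show "0 \<le> (c * f g) \<bullet> 1" .
  qed
  \<comment> \<open>The coordinates modulo \<open>L\<close> vanish on \<open>L\<close>, so they kill
    \<open>g\<close>; the coordinate expansion of \<open>g\<close> then leaves \<open>g\<close>
    itself in \<open>L\<close>.\<close>
  have "e k g = 0" if "k < d" for k
    using e that by (intro fg) (simp add: A_def)
  then have gL: "g \<in> L" using b[of g] by simp
  define \<alpha> where "\<alpha> = (\<lambda>i. if i < N then \<beta> i else 0)"
  have \<alpha>: "\<alpha> \<in> conj_ball p" unfolding \<alpha>_def by (rule conj_ball_if_dominated[OF p \<beta>])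
  have "sums_in (quotient_nspace sF L) (\<lambda>n. smult (quotient_nspace sF L) (\<alpha> n)
      (coset L (if n < N then z n else 0))) (coset L u)"
    unfolding F.sums_in_quotient_iff[OF L']
  proof (rule tendsto_eventually, rule eventually_sequentiallyI)
    fix n assume n: "N \<le> n"
    have "(\<Sum>i<n. sF (\<alpha> i) (if i < N then z i else 0)) = (\<Sum>i<N. sF (\<beta> i) (z i))"
      using n by (intro sum.mono_neutral_cong_right) (auto simp: \<alpha>_def)
    then show "nrm (quotient_nspace sF L) (coset L ((\<Sum>i<n. sF (\<alpha> i) (if i < N then z i else 0)) - u)) = 0"
      using F.quotient_nrm_eq_0[OF L' gL] by (simp add: g_def)
  qed
  with \<alpha> show ?thesis unfolding p_co_def by blast
qed

text \<open>The domination controls the norm of \<open>f\<close> composed with \<open>T\<close>, so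
  the same finite sequence covers the images of all points of the unit ball of E, whatever the
  subspace \<open>M\<close>.\<close>

lemma max_hull_norm_le_if_p_summing_bound:
  assumes p: "1 \<le> p" and C: "0 \<le> C"
    and bound: "p_summing_bound p F.dual E.dual (adjoint_op (whole_nspace sE) (whole_nspace sF) T) C"
  shows "max_hull_norm (p_compact_norm p) sE sF T \<le> ennreal C"
  unfolding max_hull_norm_def
proof (intro SUP_least)
  fix M L assume L: "L \<in> closed_fin_codim_subspaces sF"
  have L': "F.subspace L" using L by (simp add: closed_fin_codim_subspaces_def)
  let ?Q = "quotient_nspace sF L"
  show "p_compact_norm p (subspace_nspace sE M) ?Q (\<lambda>x. coset L (T x)) \<le> ennreal C"
  proof (rule ennreal_le_epsilon)
    fix \<eta> :: real assume \<eta>: "\<eta> > 0"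
    define C' where "C' = C + \<eta>"
    have C': "C < C'" "0 \<le> C'" using \<eta> C by (auto simp: C'_def)
    obtain N z where z: "(\<Sum>j<N::nat. norm (z j) powr p) \<le> C' powr p"
      and dom: "\<And>f. f \<in> carrier F.dual \<Longrightarrow> (\<forall>l\<in>L. f l = 0) \<Longrightarrow>
        nrm E.dual (\<lambda>x. f (T x)) \<le> psum p N (\<lambda>j. f (z j))"
      by (rule adjoint_dominated[OF p C C'(1) L bound]) auto
    \<comment> \<open>The zero coset pads the finite family to a sequence without changing its norm;
      passing to cosets can only shrink the norms of the \<open>z n\<close>.\<close>
    define y where "y n = coset L (if n < N then z n else 0)" for n
    have 0: "nrm ?Q (y n) powr p = 0" if "n \<notin> {..<N}" for n
      using that F.quotient_nrm_eq_0[OF L' F.subspace_0[OF L']] by (simp add: y_def)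
    have "y \<in> lp_space p ?Q"
      unfolding lp_space_def using summable_finite[of "{..<N}", OF _ 0]
      by (auto simp: y_def quotient_nspace_simps(1))
    moreover have "(\<lambda>x. coset L (T x)) ` unit_ball (subspace_nspace sE M) \<subseteq> p_co p ?Q y"
    proof (rule image_subsetI)
      fix x assume "x \<in> unit_ball (subspace_nspace sE M)"
      then have x: "norm x \<le> 1" by (simp add: unit_ball_def)
      have "norm (f (T x)) \<le> psum p N (\<lambda>j. f (z j))" if f: "f \<in> carrier F.dual" "\<forall>l\<in>L. f l = 0" for f
      proof -
        have f': "(\<lambda>x. f (T x)) \<in> carrier E.dual" by (rule comp_dual[OF f(1)])
        have "norm (f (T x)) \<le> nrm E.dual (\<lambda>x. f (T x))"
          using E.dual_le[OF f', of x] mult_left_mono[OF x E.dual_nonneg[OF f']] by simp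
        with dom[OF f] show ?thesis by simp
      qed
      then show "coset L (T x) \<in> p_co p ?Q y"
        unfolding y_def by (rule mem_p_co_if_dominated[OF p L])
    qed
    moreover have "lp_norm p ?Q y \<le> C'"
    proof -
      have "(\<Sum>n. nrm ?Q (y n) powr p) = (\<Sum>n<N. nrm ?Q (y n) powr p)"
        by (rule suminf_finite) (use 0 in auto)
      also have "\<dots> \<le> (\<Sum>n<N. norm (z n) powr p)"
        using p F.quotient_nrm_nonneg[OF L'] F.quotient_nrm_le_norm[OF L']
        by (intro sum_mono powr_mono2) (auto simp: y_def)
      also note z
      finally have "(\<Sum>n. nrm ?Q (y n) powr p) powr (1 / p) \<le> (C' powr p) powr (1 / p)"
        using p by (intro powr_mono2) (auto intro: suminf_nonneg summable_finite[of "{..<N}", OF _ 0])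
      then show ?thesis using p C' by (simp add: lp_norm_def powr_powr)
    qed
    ultimately have "p_compact_norm p (subspace_nspace sE M) ?Q (\<lambda>x. coset L (T x)) \<le> ennreal C'"
      unfolding p_compact_norm_def by (intro INF_lower2[of y]) (auto intro: ennreal_leI)
    then show "p_compact_norm p (subspace_nspace sE M) ?Q (\<lambda>x. coset L (T x)) \<le> ennreal C + ennreal \<eta>"
      using C \<eta> by (simp add: C'_def)
  qed
qed

text \<open>The equality covers the value infinity, so equality of the two ideals is read off from
  finiteness. A finite left-hand value is itself an admissible constant for the adjoint.\<close>

lemma max_hull_norm_eq:
  assumes p: "1 \<le> p"
  shows "max_hull_norm (p_compact_norm p) sE sF T
    = dual_ideal_norm (p_summing_norm p) (whole_nspace sE) (whole_nspace sF) T"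
proof (rule antisym)
  show "max_hull_norm (p_compact_norm p) sE sF T
      \<le> dual_ideal_norm (p_summing_norm p) (whole_nspace sE) (whole_nspace sF) T"
    unfolding dual_ideal_norm_def p_summing_norm_def
    using max_hull_norm_le_if_p_summing_bound[OF p] by (intro INF_greatest) auto
  show "dual_ideal_norm (p_summing_norm p) (whole_nspace sE) (whole_nspace sF) T
      \<le> max_hull_norm (p_compact_norm p) sE sF T"
  proof (cases "max_hull_norm (p_compact_norm p) sE sF T")
    case (real C)
    then show ?thesis
      using p_summing_bound_if_max_hull_norm_le[OF p, of C]
      unfolding dual_ideal_norm_def p_summing_norm_def by (intro INF_lower2[of C]) auto
  qed simp
qed

lemma max_hull_norm_finite_iff:
  assumes p: "1 \<le> p"
  shows "max_hull_norm (p_compact_norm p) sE sF T < \<infinity> \<longleftrightarrow>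
    adjoint_op (whole_nspace sE) (whole_nspace sF) T \<in> p_summing p F.dual E.dual"
  unfolding max_hull_norm_eq[OF p] dual_ideal_norm_def p_summing_norm_def p_summing_def INF_less_iff
  using adjoint_bounded by auto

end

theorem corollary3p6:
  fixes p :: real
    and sE :: "'k::{real_normed_field,euclidean_space} \<Rightarrow> 'a::banach \<Rightarrow> 'a"
    and sF :: "'k \<Rightarrow> 'b::banach \<Rightarrow> 'b"
  assumes "1 \<le> p"
    and "normed_space_over sE"
    and "normed_space_over sF"
  shows "max_hull (p_compact_norm p) sE sF
           = dual_ideal (p_summing p) (whole_nspace sE) (whole_nspace sF) \<and>
         (\<forall>T \<in> max_hull (p_compact_norm p) sE sF.
            max_hull_norm (p_compact_norm p) sE sF T
              = dual_ideal_norm (p_summing_norm p) (whole_nspace sE) (whole_nspace sF) T)"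
proof -
  have op: "bounded_operator sE sF T" if "T \<in> bounded_ops (whole_nspace sE) (whole_nspace sF)" for T
    using assms that by (simp add: bounded_operator_def bounded_operator_axioms_def)
  note bounded_operator.max_hull_norm_finite_iff[OF op assms(1)]
    and bounded_operator.max_hull_norm_eq[OF op assms(1)]
  then show ?thesis unfolding max_hull_def dual_ideal_def by blast
qed

end
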